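(* Let $\tau\neq0$, $\delta\in\{1,-1\}$, and let $M$ be a helix surface in the Lorentzian Heisenberg group $H_3(\tau)=(\mathbb{R}^3,g_\tau)$, $g_\tau=dx^2-\delta\,dy^2+\delta\,(dz+\tau(y\,dx-x\,dy))^2$, with unit normal $N$, $g_\tau(N,N)=\varepsilon\in\{1,-1\}$, and constant angle $\nu=\varepsilon g_\tau(N,E_3)$. Let $T$ be the tangential projection of $E_3$ on $M$ and $JT=N\wedge T$, and consider the tangent basis $\{T,JT\}$ (so $T$ and $JT$ are assumed to be linearly independent at every point). Then: (i) the shape operator $S$ of $M$ with respect to $\{T,JT\}$ is $$S=\begin{pmatrix}0&\delta\varepsilon\tau\\-\delta\tau&\mu\end{pmatrix},$$ i.e. $ST=-\delta\tau\,JT$ and $S(JT)=\delta\varepsilon\tau\,T+\mu\,JT$, for some smooth function $\mu$ on $M$; (ii) the Levi-Civita connection $\nabla$ of $M$ is given by $$\nabla_TT=-2\delta\tau\nu\,JT,\quad \nabla_{JT}T=\mu\nu\,JT,\quad \nabla_TJT=-2\varepsilon\delta\tau\nu\,T,\quad \nabla_{JT}JT=\varepsilon\mu\nu\,T;$$ (iii) the Gaussian curvature of $M$ is constant, $K=4\delta\varepsilon\tau^2\nu^2$; (iv) the function $\mu$ satisfies $T(\mu)+\mu^2\nu-4\delta\tau^2\nu^3=0$.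
   Context: On $H_3(\tau)$ consider the orthonormal frame $E_1=\partial_x-\tau y\,\partial_z$, $E_2=\partial_y+\tau x\,\partial_z$, $E_3=\partial_z$, with $g_\tau(E_1,E_1)=1$, $g_\tau(E_2,E_2)=-\delta$, $g_\tau(E_3,E_3)=\delta$, and $[E_1,E_2]=2\tau E_3$, $[E_2,E_3]=[E_3,E_1]=0$. The cross product is the bilinear skew-symmetric product with $E_1\wedge E_2=\delta E_3$, $E_2\wedge E_3=E_1$, $E_1\wedge E_3=\delta E_2$. Surfaces are oriented with nondegenerate induced metric and a unit normal field $N$, $g_\tau(N,N)=\varepsilon=\pm1$. The shape operator is $SX=-\nabla^\tau_XN$, with $\nabla^\tau$ the Levi-Civita connection of $g_\tau$. The angle function is $\nu=\varepsilon g_\tau(N,E_3)$, so $E_3=T+\nu N$ with $T$ tangent; $M$ is a helix (constant angle) surface if $\nu$ is a real constant. $JX=N\wedge X$ for $X$ tangent to $M$. *)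

theory Defs
  imports "HOL-Analysis.Analysis"
begin

section \<open>Smooth maps\<close>

text \<open>\<open>Ck_on k U f\<close>: \<open>f\<close> is \<open>k\<close> times continuously differentiable on the open set \<open>U\<close>.\<close>

fun Ck_on :: "nat \<Rightarrow> 'a::real_normed_vector set \<Rightarrow> ('a \<Rightarrow> 'b::real_normed_vector) \<Rightarrow> bool" where
  "Ck_on 0 U f \<longleftrightarrow> continuous_on U f"
| "Ck_on (Suc k) U f \<longleftrightarrow>
     (\<forall>u\<in>U. f differentiable (at u)) \<and> (\<forall>v. Ck_on k U (\<lambda>u. frechet_derivative f (at u) v))"

definition smooth_on :: "'a::real_normed_vector set \<Rightarrow> ('a \<Rightarrow> 'b::real_normed_vector) \<Rightarrow> bool" where
  "smooth_on U f \<longleftrightarrow> (\<forall>k. Ck_on k U f)"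


section \<open>Pseudo-Riemannian geometry in coordinates\<close>

text \<open>\<open>G p u v\<close> is the value at the point \<open>p\<close> of the metric on the tangent vectors \<open>u\<close>, \<open>v\<close>.\<close>

type_synonym 'n metric = "real^'n \<Rightarrow> real^'n \<Rightarrow> real^'n \<Rightarrow> real"

definition metric_matrix :: "'n::finite metric \<Rightarrow> real^'n \<Rightarrow> real^'n^'n" where
  "metric_matrix G p = (\<chi> i j. G p (axis i 1) (axis j 1))"

definition partial_deriv :: "'n::finite \<Rightarrow> (real^'n \<Rightarrow> real) \<Rightarrow> real^'n \<Rightarrow> real" where
  "partial_deriv i F p = frechet_derivative F (at p) (axis i 1)"

text \<open>The Christoffel symbol \<open>\<Gamma>\<^sup>k\<^sub>i\<^sub>j\<close> of the Levi-Civita connection of \<open>G\<close>.\<close>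

definition christoffel :: "'n::finite metric \<Rightarrow> real^'n \<Rightarrow> 'n \<Rightarrow> 'n \<Rightarrow> 'n \<Rightarrow> real" where
  "christoffel G p k i j =
     (\<Sum>l\<in>UNIV. matrix_inv (metric_matrix G p) $ k $ l *
        (partial_deriv i (\<lambda>q. metric_matrix G q $ j $ l) p
         + partial_deriv j (\<lambda>q. metric_matrix G q $ i $ l) p
         - partial_deriv l (\<lambda>q. metric_matrix G q $ i $ j) p)) / 2"

definition christoffel_form :: "'n::finite metric \<Rightarrow> real^'n \<Rightarrow> real^'n \<Rightarrow> real^'n \<Rightarrow> real^'n" where
  "christoffel_form G p X Y =
     (\<chi> k. \<Sum>i\<in>UNIV. \<Sum>j\<in>UNIV. christoffel G p k i j * X $ i * Y $ j)"

text \<open>Covariant derivative, at the parameter \<open>u\<close> and in the parameter direction \<open>w\<close>, of a vector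
  field \<open>V\<close> along the map \<open>\<phi>\<close> with respect to the Levi-Civita connection of \<open>G\<close>.\<close>

definition cov_along ::
  "'n::finite metric \<Rightarrow> (real^'m \<Rightarrow> real^'n) \<Rightarrow> real^'m \<Rightarrow> real^'m \<Rightarrow> (real^'m \<Rightarrow> real^'n) \<Rightarrow> real^'n"
where
  "cov_along G \<phi> u w V =
     frechet_derivative V (at u) w
     + christoffel_form G (\<phi> u) (frechet_derivative \<phi> (at u) w) (V u)"

definition levi_civita ::
  "'n::finite metric \<Rightarrow> (real^'n \<Rightarrow> real^'n) \<Rightarrow> (real^'n \<Rightarrow> real^'n) \<Rightarrow> real^'n \<Rightarrow> real^'n" where
  "levi_civita G X Y p = cov_along G (\<lambda>q. q) p (X p) Y"

definition lie_bracket ::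
  "(real^'n \<Rightarrow> real^'n) \<Rightarrow> (real^'n \<Rightarrow> real^'n) \<Rightarrow> real^'n \<Rightarrow> real^'n" where
  "lie_bracket X Y p =
     frechet_derivative Y (at p) (X p) - frechet_derivative X (at p) (Y p)"

definition riemann ::
  "'n::finite metric \<Rightarrow> (real^'n \<Rightarrow> real^'n) \<Rightarrow> (real^'n \<Rightarrow> real^'n) \<Rightarrow> (real^'n \<Rightarrow> real^'n)
     \<Rightarrow> real^'n \<Rightarrow> real^'n" where
  "riemann G X Y Z p =
     levi_civita G X (levi_civita G Y Z) p - levi_civita G Y (levi_civita G X Z) p
     - levi_civita G (lie_bracket X Y) Z p"

text \<open>The sectional curvature \<open>g(R(X,Y)Y,X) / (g(X,X) g(Y,Y) - g(X,Y)\<^sup>2)\<close> of a two-dimensional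
  metric, evaluated on the coordinate fields.\<close>

definition gauss_curvature :: "2 metric \<Rightarrow> real^2 \<Rightarrow> real" where
  "gauss_curvature h u =
     (let e1 = axis 1 1; e2 = axis 2 1
      in h u (riemann h (\<lambda>_. e1) (\<lambda>_. e2) (\<lambda>_. e2) u) e1
         / (h u e1 e1 * h u e2 e2 - (h u e1 e2)\<^sup>2))"


section \<open>The Lorentzian Heisenberg group\<close>

definition contact_form :: "real \<Rightarrow> real^3 \<Rightarrow> real^3 \<Rightarrow> real" where
  "contact_form \<tau> p u = u$3 + \<tau> * (p$2 * u$1 - p$1 * u$2)"

definition heis_metric :: "real \<Rightarrow> real \<Rightarrow> 3 metric" where
  "heis_metric \<tau> \<delta> p u v =
     u$1 * v$1 - \<delta> * (u$2 * v$2) + \<delta> * (contact_form \<tau> p u * contact_form \<tau> p v)"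

definition E1 :: "real \<Rightarrow> real^3 \<Rightarrow> real^3" where
  "E1 \<tau> p = vector [1, 0, - \<tau> * p$2]"

definition E2 :: "real \<Rightarrow> real^3 \<Rightarrow> real^3" where
  "E2 \<tau> p = vector [0, 1, \<tau> * p$1]"

definition E3 :: "real^3 \<Rightarrow> real^3" where
  "E3 p = vector [0, 0, 1]"

text \<open>A tangent vector \<open>u\<close> at \<open>p\<close> is \<open>u$1 E\<^sub>1 + u$2 E\<^sub>2 + contact_form \<tau> p u E\<^sub>3\<close>
  (\<open>frame_expansion\<close> below); the product is the bilinear skew-symmetric one with
  \<open>E\<^sub>1 \<and> E\<^sub>2 = \<delta> E\<^sub>3\<close>, \<open>E\<^sub>2 \<and> E\<^sub>3 = E\<^sub>1\<close>, \<open>E\<^sub>1 \<and> E\<^sub>3 = \<delta> E\<^sub>2\<close>.\<close>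

definition heis_cross :: "real \<Rightarrow> real \<Rightarrow> real^3 \<Rightarrow> real^3 \<Rightarrow> real^3 \<Rightarrow> real^3" where
  "heis_cross \<tau> \<delta> p u v =
     (u$1 * v$2 - u$2 * v$1) *\<^sub>R (\<delta> *\<^sub>R E3 p)
     + (u$2 * contact_form \<tau> p v - contact_form \<tau> p u * v$2) *\<^sub>R E1 \<tau> p
     + (u$1 * contact_form \<tau> p v - contact_form \<tau> p u * v$1) *\<^sub>R (\<delta> *\<^sub>R E2 \<tau> p)"

lemmas heis_defs = heis_metric_def heis_cross_def contact_form_def E1_def E2_def E3_def

lemma frame_expansion: "u = u$1 *\<^sub>R E1 \<tau> p + u$2 *\<^sub>R E2 \<tau> p + contact_form \<tau> p u *\<^sub>R E3 p"
  by (simp add: heis_defs vec_eq_iff forall_3 algebra_simps)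

lemma frechet_derivative_frame:
  "frechet_derivative (E1 \<tau>) (at p) = (\<lambda>v. (- \<tau> * v$2) *\<^sub>R axis 3 1)"
  "frechet_derivative (E2 \<tau>) (at p) = (\<lambda>v. (\<tau> * v$1) *\<^sub>R axis 3 1)"
  "frechet_derivative E3 (at p) = (\<lambda>v. 0)"
proof -
  have E: "E1 \<tau> = (\<lambda>p. axis 1 1 + (- \<tau> * p$2) *\<^sub>R axis 3 1)"
    "E2 \<tau> = (\<lambda>p. axis 2 1 + (\<tau> * p$1) *\<^sub>R axis 3 1)" "E3 = (\<lambda>p. axis 3 1)"
    by (auto simp: fun_eq_iff vec_eq_iff forall_3 E1_def E2_def E3_def axis_def)
  have "((\<lambda>p::real^3. axis 1 1 + (- \<tau> * p$2) *\<^sub>R axis 3 1 :: real^3) has_derivative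
      (\<lambda>v. (- \<tau> * v$2) *\<^sub>R axis 3 1)) (at p)"
    "((\<lambda>p::real^3. axis 2 1 + (\<tau> * p$1) *\<^sub>R axis 3 1 :: real^3) has_derivative
      (\<lambda>v. (\<tau> * v$1) *\<^sub>R axis 3 1)) (at p)"
    by (auto intro!: derivative_eq_intros bounded_linear.has_derivative[OF bounded_linear_vec_nth])
  then show "frechet_derivative (E1 \<tau>) (at p) = (\<lambda>v. (- \<tau> * v$2) *\<^sub>R axis 3 1)"
    "frechet_derivative (E2 \<tau>) (at p) = (\<lambda>v. (\<tau> * v$1) *\<^sub>R axis 3 1)"
    "frechet_derivative E3 (at p) = (\<lambda>v. 0)"
    unfolding E by (auto dest!: frechet_derivative_at)
qed

lemma frame_bracket:
  "lie_bracket (E1 \<tau>) (E2 \<tau>) p = (2 * \<tau>) *\<^sub>R E3 p"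
  "lie_bracket (E2 \<tau>) E3 p = 0"
  "lie_bracket E3 (E1 \<tau>) p = 0"
  by (simp_all add: lie_bracket_def frechet_derivative_frame vec_eq_iff forall_3 E1_def E2_def
      E3_def axis_def)

lemma frame_metric:
  "heis_metric \<tau> \<delta> p (E1 \<tau> p) (E1 \<tau> p) = 1"
  "heis_metric \<tau> \<delta> p (E2 \<tau> p) (E2 \<tau> p) = - \<delta>"
  "heis_metric \<tau> \<delta> p (E3 p) (E3 p) = \<delta>"
  "heis_metric \<tau> \<delta> p (E1 \<tau> p) (E2 \<tau> p) = 0"
  "heis_metric \<tau> \<delta> p (E1 \<tau> p) (E3 p) = 0"
  "heis_metric \<tau> \<delta> p (E2 \<tau> p) (E3 p) = 0"
  by (simp_all add: heis_defs)

lemma frame_cross: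
  "heis_cross \<tau> \<delta> p (E1 \<tau> p) (E2 \<tau> p) = \<delta> *\<^sub>R E3 p"
  "heis_cross \<tau> \<delta> p (E2 \<tau> p) (E3 p) = E1 \<tau> p"
  "heis_cross \<tau> \<delta> p (E1 \<tau> p) (E3 p) = \<delta> *\<^sub>R E2 \<tau> p"
  by (simp_all add: heis_defs vec_eq_iff forall_3)

lemma heis_cross_skew: "heis_cross \<tau> \<delta> p u v = - heis_cross \<tau> \<delta> p v u"
  by (simp add: heis_defs vec_eq_iff forall_3 algebra_simps)

lemma heis_cross_bilinear: "bilinear (heis_cross \<tau> \<delta> p)"
  by (auto simp: bilinear_def heis_defs vec_eq_iff forall_3 algebra_simps intro!: linearI)


section \<open>Immersed surfaces\<close>

text \<open>A surface is a topological space \<open>M\<close> with a map \<open>f\<close> into \<open>\<real>\<^sup>3\<close> that is a smooth immersion in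
  suitable local parametrizations \<open>\<psi>\<close> of \<open>M\<close>. This determines the smooth structure of \<open>M\<close>:
  \<open>local_param M f\<close> is its maximal atlas (of inverse charts), because a continuous transition map
  \<open>\<psi>\<^sub>2\<^sup>-\<^sup>1 \<circ> \<psi>\<^sub>1\<close> with \<open>f \<circ> \<psi>\<^sub>1\<close> and \<open>f \<circ> \<psi>\<^sub>2\<close> smooth immersions is smooth. Embedded surfaces
  are the case where \<open>f\<close> is the inclusion. Vector fields of \<open>\<real>\<^sup>3\<close> along \<open>M\<close>, in particular
  tangent fields, are functions from \<open>M\<close> to \<open>\<real>\<^sup>3\<close>.\<close>

definition local_param ::
  "'a topology \<Rightarrow> ('a \<Rightarrow> real^3) \<Rightarrow> (real^2) set \<Rightarrow> (real^2 \<Rightarrow> 'a) \<Rightarrow> bool" where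
  "local_param M f U \<psi> \<longleftrightarrow>
     open U \<and> openin M (\<psi> ` U) \<and>
     homeomorphic_map (top_of_set U) (subtopology M (\<psi> ` U)) \<psi> \<and>
     smooth_on U (f \<circ> \<psi>) \<and> (\<forall>u\<in>U. inj (frechet_derivative (f \<circ> \<psi>) (at u)))"

definition immersed_surface :: "'a topology \<Rightarrow> ('a \<Rightarrow> real^3) \<Rightarrow> bool" where
  "immersed_surface M f \<longleftrightarrow>
     Hausdorff_space M \<and> second_countable M \<and>
     (\<forall>p\<in>topspace M. \<exists>U \<psi>. local_param M f U \<psi> \<and> p \<in> \<psi> ` U)"

definition smooth_on_surface ::
  "'a topology \<Rightarrow> ('a \<Rightarrow> real^3) \<Rightarrow> ('a \<Rightarrow> 'b::real_normed_vector) \<Rightarrow> bool" where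
  "smooth_on_surface M f h \<longleftrightarrow> (\<forall>U \<psi>. local_param M f U \<psi> \<longrightarrow> smooth_on U (h \<circ> \<psi>))"

definition induced_metric :: "3 metric \<Rightarrow> (real^2 \<Rightarrow> real^3) \<Rightarrow> 2 metric" where
  "induced_metric G \<phi> u v w =
     G (\<phi> u) (frechet_derivative \<phi> (at u) v) (frechet_derivative \<phi> (at u) w)"

text \<open>Surfaces with nondegenerate induced metric, oriented by a smooth unit normal field \<open>N\<close>
  of causal character \<open>\<epsilon>\<close>.\<close>

definition oriented_surface ::
  "3 metric \<Rightarrow> real \<Rightarrow> 'a topology \<Rightarrow> ('a \<Rightarrow> real^3) \<Rightarrow> ('a \<Rightarrow> real^3) \<Rightarrow> bool" where
  "oriented_surface G \<epsilon> M f N \<longleftrightarrow>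
     immersed_surface M f \<and>
     (\<forall>U \<psi>. local_param M f U \<psi> \<longrightarrow>
        (\<forall>u\<in>U. \<forall>v. (\<forall>w. induced_metric G (f \<circ> \<psi>) u v w = 0) \<longrightarrow> v = 0)) \<and>
     smooth_on_surface M f N \<and>
     (\<forall>p\<in>topspace M. G (f p) (N p) (N p) = \<epsilon>) \<and>
     (\<forall>U \<psi>. local_param M f U \<psi> \<longrightarrow>
        (\<forall>u\<in>U. \<forall>v. G (f (\<psi> u)) (N (\<psi> u)) (frechet_derivative (f \<circ> \<psi>) (at u) v) = 0))"

text \<open>The following operations take a parametrization \<open>\<phi>\<close> of a piece of the surface (in use,
  \<open>\<phi> = f \<circ> \<psi>\<close>) and fields along it, given as functions of the parameter \<open>u\<close>; tangent vectors are
  vectors in \<open>\<real>\<^sup>3\<close>, and \<open>tangent_coords \<phi> u X\<close> are the coordinates of a tangent vector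
  \<open>X\<close> in the coordinate basis.\<close>

definition tangent_coords :: "(real^2 \<Rightarrow> real^3) \<Rightarrow> real^2 \<Rightarrow> real^3 \<Rightarrow> real^2" where
  "tangent_coords \<phi> u X = (THE w. frechet_derivative \<phi> (at u) w = X)"

definition dir_deriv ::
  "(real^2 \<Rightarrow> real^3) \<Rightarrow> real^2 \<Rightarrow> real^3 \<Rightarrow> (real^2 \<Rightarrow> real) \<Rightarrow> real" where
  "dir_deriv \<phi> u X F = frechet_derivative F (at u) (tangent_coords \<phi> u X)"

definition shape_operator ::
  "3 metric \<Rightarrow> (real^2 \<Rightarrow> real^3) \<Rightarrow> (real^2 \<Rightarrow> real^3) \<Rightarrow> real^2 \<Rightarrow> real^3 \<Rightarrow> real^3" where
  "shape_operator G \<phi> n u X = - cov_along G \<phi> u (tangent_coords \<phi> u X) n"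

text \<open>The Levi-Civita connection of the induced metric, transported to \<open>\<real>\<^sup>3\<close>-valued tangent
  fields by the differential of \<open>\<phi>\<close>.\<close>

definition surface_connection ::
  "3 metric \<Rightarrow> (real^2 \<Rightarrow> real^3) \<Rightarrow> (real^2 \<Rightarrow> real^3) \<Rightarrow> (real^2 \<Rightarrow> real^3) \<Rightarrow> real^2 \<Rightarrow> real^3"
where
  "surface_connection G \<phi> X Y u =
     frechet_derivative \<phi> (at u)
       (levi_civita (induced_metric G \<phi>)
          (\<lambda>v. tangent_coords \<phi> v (X v)) (\<lambda>v. tangent_coords \<phi> v (Y v)) u)"


section \<open>Helix surfaces\<close>

definition angle_function ::
  "real \<Rightarrow> real \<Rightarrow> real \<Rightarrow> ('a \<Rightarrow> real^3) \<Rightarrow> ('a \<Rightarrow> real^3) \<Rightarrow> 'a \<Rightarrow> real" where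
  "angle_function \<tau> \<delta> \<epsilon> f N p = \<epsilon> * heis_metric \<tau> \<delta> (f p) (N p) (E3 (f p))"

definition helix_surface ::
  "real \<Rightarrow> real \<Rightarrow> real \<Rightarrow> 'a topology \<Rightarrow> ('a \<Rightarrow> real^3) \<Rightarrow> ('a \<Rightarrow> real^3) \<Rightarrow> real \<Rightarrow> bool" where
  "helix_surface \<tau> \<delta> \<epsilon> M f N \<nu> \<longleftrightarrow>
     oriented_surface (heis_metric \<tau> \<delta>) \<epsilon> M f N \<and>
     (\<forall>p\<in>topspace M. angle_function \<tau> \<delta> \<epsilon> f N p = \<nu>)"

text \<open>The tangential projection of \<open>E\<^sub>3\<close>, i.e. \<open>T\<close> in \<open>E\<^sub>3 = T + \<nu> N\<close>.\<close>

definition T_field ::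
  "real \<Rightarrow> real \<Rightarrow> real \<Rightarrow> ('a \<Rightarrow> real^3) \<Rightarrow> ('a \<Rightarrow> real^3) \<Rightarrow> 'a \<Rightarrow> real^3" where
  "T_field \<tau> \<delta> \<epsilon> f N p = E3 (f p) - angle_function \<tau> \<delta> \<epsilon> f N p *\<^sub>R N p"

definition JT_field ::
  "real \<Rightarrow> real \<Rightarrow> real \<Rightarrow> ('a \<Rightarrow> real^3) \<Rightarrow> ('a \<Rightarrow> real^3) \<Rightarrow> 'a \<Rightarrow> real^3" where
  "JT_field \<tau> \<delta> \<epsilon> f N p = heis_cross \<tau> \<delta> (f p) (N p) (T_field \<tau> \<delta> \<epsilon> f N p)"

end

theory Submission
  imports Defs
begin

text \<open>
  The frame \<open>E\<^sub>1, E\<^sub>2, E\<^sub>3\<close> turns the constant angle condition into a statement about a conic. The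
  third frame component of the unit normal is \<open>\<epsilon>\<delta>\<nu>\<close>, a constant, so the other two satisfy
  \<open>N\<^sub>1\<^sup>2 - \<delta> N\<^sub>2\<^sup>2 = c\<close> with the constant \<open>c = \<epsilon> - \<delta>\<nu>\<^sup>2\<close>, which equals \<open>\<epsilon>\<delta> g(T,T)\<close>. Linear
  independence of \<open>T\<close> and \<open>JT\<close> forces \<open>c \<noteq> 0\<close> (\<open>c_nonzero_if_independent\<close>). A point that moves on a
  nondegenerate conic has one degree of freedom: with \<open>\<omega> = (N\<^sub>1 dN\<^sub>2 - N\<^sub>2 dN\<^sub>1) / c\<close> one has
  \<open>dN\<^sub>1 = \<delta> N\<^sub>2 \<omega>\<close> and \<open>dN\<^sub>2 = N\<^sub>1 \<omega>\<close> (\<open>dn_components\<close>). Locally \<open>\<omega>\<close> is the differential of the circular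
  or hyperbolic angle on the conic, hence closed (\<open>\<omega>_closed\<close>). The other ingredient is the contact
  form \<open>\<eta>\<close>, whose differential \<open>-2\<tau> dx \<and> dy\<close> is explicit (\<open>d\<eta>\<close>).

  All four claims are read off from \<open>\<omega>\<close> and \<open>\<eta>\<close>. Differentiating \<open>g(N, \<cdot>) = 0\<close> on the surface and
  antisymmetrizing, which is the symmetry of the shape operator, gives \<open>\<omega>(T) = 2\<tau>\<epsilon>\<delta>\<nu>\<^sup>2\<close>, while
  \<open>\<omega>(JT)\<close> stays free and defines \<open>\<mu> = -\<delta> \<omega>(JT)\<close>. The covariant derivative of \<open>N\<close> along \<open>T\<close> and \<open>JT\<close> is
  then known, which is (i). Because \<open>T\<close> and \<open>JT\<close> are orthogonal with constant squares \<open>\<epsilon>\<delta>c\<close> and \<open>-\<delta>c\<close>,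
  the connection of the surface is given by one form \<open>\<theta>\<close>: \<open>\<nabla>T = \<theta> JT\<close> and \<open>\<nabla>JT = \<epsilon>\<theta> T\<close>, and the
  computation yields \<open>\<theta> = -\<nu>\<delta>(\<omega> + 2\<tau>\<eta>)\<close> (\<open>nabla_a\<close>, \<open>nabla_b\<close>); evaluating \<open>\<theta>\<close> on \<open>T\<close> and \<open>JT\<close> is
  (ii). The curvature of the surface is \<open>d\<theta>\<close>, and since \<open>\<omega>\<close> is closed this is \<open>-2\<nu>\<delta>\<tau> d\<eta>\<close>, in which
  \<open>\<mu>\<close> no longer occurs; this is (iii). Finally \<open>d\<omega>(T,JT) = 0\<close> with \<open>\<omega>(T)\<close> constant says
  \<open>T(\<omega>(JT)) = \<omega>([T,JT])\<close>, which is the Riccati equation (iv) (\<open>\<mu>_riccati\<close>). Thus closedness of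
  \<open>\<omega>\<close> takes the place of the Codazzi equation.

  What remains is to connect these computations with the coordinate definitions. The Christoffel
  symbols are accessed only through the Koszul formula (\<open>koszul\<close>). It identifies the connection of
  the Heisenberg metric (\<open>heis_christoffel_form\<close>), and it shows that the connection of the induced
  metric is the tangential part of the ambient one (\<open>gauss_formula\<close>). The curvature, defined on the
  coordinate fields, is moved to the frame \<open>T, JT\<close> by tensoriality (\<open>riemann_coordinate\<close>,
  \<open>gauss_curvature_frame\<close>). The function \<open>\<mu>\<close> is defined on all of \<open>M\<close> because its value does not
  depend on the parametrization: coordinate changes, which are only assumed continuous, are
  automatically differentiable, as \<open>f\<close> is an immersion (\<open>local_param_transition\<close>).
\<close>

section \<open>Calculus of smooth maps\<close>

abbreviation ddir :: "'a::real_normed_vector \<Rightarrow> ('a \<Rightarrow> 'b::real_normed_vector) \<Rightarrow> 'a \<Rightarrow> 'b" where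
  "ddir v f u \<equiv> frechet_derivative f (at u) v"

lemma frechet_derivative_cong_on:
  assumes "open U" "u \<in> U" "\<And>x. x \<in> U \<Longrightarrow> f x = g x"
  shows "frechet_derivative f (at u) = frechet_derivative g (at u)"
proof -
  have "(f has_derivative D) (at u) \<longleftrightarrow> (g has_derivative D) (at u)" for D
    using has_derivative_transform_within_open[OF _ assms(1,2), of f D UNIV g]
      has_derivative_transform_within_open[OF _ assms(1,2), of g D UNIV f] assms(3) by auto
  then show ?thesis by (simp add: frechet_derivative_def)
qed

lemma differentiable_cong_on:
  assumes "open U" "u \<in> U" "\<And>x. x \<in> U \<Longrightarrow> f x = g x" "f differentiable (at u)"
  shows "g differentiable (at u)"
  using has_derivative_transform_within_open[OF _ assms(1,2), of f _ UNIV g] assms(3,4)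
  unfolding differentiable_def by auto

lemma has_derivative_frechet:
  "f differentiable (at u) \<Longrightarrow> (f has_derivative (\<lambda>v. ddir v f u)) (at u)"
  by (simp add: frechet_derivative_works)

lemma Ck_on_cong:
  assumes "open U" "\<And>u. u \<in> U \<Longrightarrow> f u = g u" "Ck_on k U f"
  shows "Ck_on k U g"
  using assms(2,3)
proof (induction k arbitrary: f g)
  case 0
  then show ?case by (simp cong: continuous_on_cong)
next
  case (Suc k)
  have "Ck_on k U (ddir v g)" for v
    using Suc.IH[of "ddir v f" "ddir v g"] Suc.prems frechet_derivative_cong_on[OF assms(1) _ Suc.prems(1)]
    by auto
  then show ?case using Suc.prems(2) differentiable_cong_on[OF assms(1) _ Suc.prems(1)] by auto
qed

lemma Ck_on_SucD: "Ck_on (Suc k) U f \<Longrightarrow> Ck_on k U f"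
proof (induction k arbitrary: f)
  case 0
  then show ?case
    by (auto intro!: continuous_at_imp_continuous_on dest: differentiable_imp_continuous_within)
next
  case (Suc k)
  from Suc.prems have "\<forall>u\<in>U. f differentiable (at u)" "\<And>v. Ck_on (Suc k) U (ddir v f)" by auto
  with Suc.IH show ?case unfolding Ck_on.simps(2)[of k U f] by blast
qed

lemma Ck_on_const: "Ck_on k U (\<lambda>u. c)"
proof (induction k arbitrary: c)
  case (Suc k)
  have "ddir v (\<lambda>u. c) = (\<lambda>u. 0)" for v :: 'a by auto
  then show ?case using Suc by simp
qed simp

text \<open>A variant of the defining recursion in which the derivative may be given by any formula valid on
  \<open>U\<close>; all closure properties below are inductions that use it.\<close>

lemma Ck_on_SucI:
  assumes "open U" "\<And>u. u \<in> U \<Longrightarrow> (f has_derivative (\<lambda>v. D v u)) (at u)" "\<And>v. Ck_on k U (D v)"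
  shows "Ck_on (Suc k) U f"
proof -
  have "D v u = ddir v f u" if "u \<in> U" for u v
    by (rule fun_cong[OF frechet_derivative_at[OF assms(2)[OF that]]])
  then have "Ck_on k U (ddir v f)" for v
    by (rule Ck_on_cong[OF assms(1) _ assms(3)])
  then show ?thesis using assms(2) by (auto simp: differentiable_def)
qed

lemma Ck_on_Suc_ddir: "Ck_on (Suc k) U f \<Longrightarrow> Ck_on k U (ddir v f)"
  by simp

lemma Ck_on_Suc_has_derivative:
  "Ck_on (Suc k) U f \<Longrightarrow> u \<in> U \<Longrightarrow> (f has_derivative (\<lambda>v. ddir v f u)) (at u)"
  by (intro has_derivative_frechet) simp

lemma Ck_on_linear:
  assumes "bounded_linear L" "open U" "Ck_on k U f"
  shows "Ck_on k U (\<lambda>u. L (f u))"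
  using assms(3)
proof (induction k arbitrary: f)
  case 0
  then show ?case by (simp add: bounded_linear.continuous_on[OF assms(1)])
next
  case (Suc k)
  show ?case
    by (rule Ck_on_SucI[OF assms(2), where D = "\<lambda>v u. L (ddir v f u)"])
      (rule bounded_linear.has_derivative[OF assms(1)] Suc.IH
        Ck_on_Suc_has_derivative[OF Suc.prems] Ck_on_Suc_ddir[OF Suc.prems] | assumption)+
qed

lemma Ck_on_add:
  assumes "open U" "Ck_on k U f" "Ck_on k U g"
  shows "Ck_on k U (\<lambda>u. f u + g u)"
  using assms(2,3)
proof (induction k arbitrary: f g)
  case 0
  then show ?case by (simp add: continuous_on_add)
next
  case (Suc k)
  show ?case
    by (rule Ck_on_SucI[OF assms(1), where D = "\<lambda>v u. ddir v f u + ddir v g u"])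
      (rule has_derivative_add Suc.IH Ck_on_Suc_has_derivative[OF Suc.prems(1)]
        Ck_on_Suc_has_derivative[OF Suc.prems(2)] Ck_on_Suc_ddir[OF Suc.prems(1)]
        Ck_on_Suc_ddir[OF Suc.prems(2)] | assumption)+
qed

lemma Ck_on_bilinear:
  assumes "bounded_bilinear B" "open U" "Ck_on k U f" "Ck_on k U g"
  shows "Ck_on k U (\<lambda>u. B (f u) (g u))"
  using assms(3,4)
proof (induction k arbitrary: f g)
  case 0
  then show ?case by (simp add: bounded_bilinear.continuous_on[OF assms(1)])
next
  case (Suc k)
  show ?case
    by (rule Ck_on_SucI[OF assms(2), where D = "\<lambda>v u. B (f u) (ddir v g u) + B (ddir v f u) (g u)"])
      (rule bounded_bilinear.FDERIV[OF assms(1)] Ck_on_add[OF assms(2)] Suc.IH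
        Ck_on_Suc_has_derivative[OF Suc.prems(1)] Ck_on_Suc_has_derivative[OF Suc.prems(2)]
        Ck_on_Suc_ddir[OF Suc.prems(1)] Ck_on_Suc_ddir[OF Suc.prems(2)]
        Ck_on_SucD[OF Suc.prems(1)] Ck_on_SucD[OF Suc.prems(2)] | assumption)+
qed

lemma Ck_on_inverse:
  fixes f :: "'a::real_normed_vector \<Rightarrow> real"
  assumes "open U" "\<And>u. u \<in> U \<Longrightarrow> f u \<noteq> 0" "Ck_on k U f"
  shows "Ck_on k U (\<lambda>u. inverse (f u))"
  using assms(3)
proof (induction k)
  case 0
  then show ?case using assms(2) by (auto intro!: continuous_on_inverse)
next
  case (Suc k)
  show ?case
    by (rule Ck_on_SucI[OF assms(1), where D = "\<lambda>v u. - (inverse (f u) * ddir v f u * inverse (f u))"])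
      (rule Deriv.has_derivative_inverse Ck_on_linear[OF bounded_linear_minus[OF bounded_linear_ident] assms(1)]
        Ck_on_bilinear[OF bounded_bilinear_mult assms(1)] assms(2)
        Ck_on_Suc_has_derivative[OF Suc.prems] Ck_on_Suc_ddir[OF Suc.prems]
        Suc.IH[OF Ck_on_SucD[OF Suc.prems]] | assumption)+
qed

lemma smooth_on_cong:
  "open U \<Longrightarrow> (\<And>u. u \<in> U \<Longrightarrow> f u = g u) \<Longrightarrow> smooth_on U f \<Longrightarrow> smooth_on U g"
  unfolding smooth_on_def using Ck_on_cong by blast

lemma smooth_on_differentiable: "smooth_on U f \<Longrightarrow> u \<in> U \<Longrightarrow> f differentiable (at u)"
  unfolding smooth_on_def by (metis Ck_on.simps(2))

lemma smooth_on_ddir: "smooth_on U f \<Longrightarrow> smooth_on U (ddir v f)"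
  unfolding smooth_on_def by (metis Ck_on.simps(2))

lemma smooth_on_continuous_on: "smooth_on U f \<Longrightarrow> continuous_on U f"
  unfolding smooth_on_def by (metis Ck_on.simps(1))

lemma smooth_on_const: "smooth_on U (\<lambda>u. c)"
  by (simp add: smooth_on_def Ck_on_const)

lemma smooth_on_ident: "open U \<Longrightarrow> smooth_on U (\<lambda>q. q)"
proof -
  assume "open U"
  then have "Ck_on k U (\<lambda>q. q)" for k
    by (cases k) (auto intro!: Ck_on_SucI[where D = "\<lambda>v u. v"] Ck_on_const)
  then show ?thesis by (simp add: smooth_on_def)
qed

lemma smooth_on_empty: "smooth_on {} f"
proof -
  have "Ck_on k {} f" for k by (induction k arbitrary: f) auto
  then show ?thesis by (simp add: smooth_on_def)
qed

lemma smooth_on_linear: "bounded_linear L \<Longrightarrow> open U \<Longrightarrow> smooth_on U f \<Longrightarrow> smooth_on U (\<lambda>u. L (f u))"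
  by (simp add: smooth_on_def Ck_on_linear)

lemma smooth_on_add: "open U \<Longrightarrow> smooth_on U f \<Longrightarrow> smooth_on U g \<Longrightarrow> smooth_on U (\<lambda>u. f u + g u)"
  by (simp add: smooth_on_def Ck_on_add)

lemma smooth_on_bilinear:
  "bounded_bilinear B \<Longrightarrow> open U \<Longrightarrow> smooth_on U f \<Longrightarrow> smooth_on U g \<Longrightarrow> smooth_on U (\<lambda>u. B (f u) (g u))"
  by (simp add: smooth_on_def Ck_on_bilinear)

lemma smooth_on_inverse:
  fixes f :: "'a::real_normed_vector \<Rightarrow> real"
  shows "open U \<Longrightarrow> smooth_on U f \<Longrightarrow> (\<And>u. u \<in> U \<Longrightarrow> f u \<noteq> 0) \<Longrightarrow> smooth_on U (\<lambda>u. inverse (f u))"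
  by (simp add: smooth_on_def Ck_on_inverse)

lemmas smooth_on_mult = smooth_on_bilinear[OF bounded_bilinear_mult]
lemmas smooth_on_scaleR = smooth_on_bilinear[OF bounded_bilinear_scaleR]
lemmas smooth_on_minus = smooth_on_linear[OF bounded_linear_minus[OF bounded_linear_ident]]
lemmas smooth_on_vec_nth = smooth_on_linear[OF bounded_linear_vec_nth]

lemma smooth_on_diff: "open U \<Longrightarrow> smooth_on U f \<Longrightarrow> smooth_on U g \<Longrightarrow> smooth_on U (\<lambda>u. f u - g u)"
  using smooth_on_add[of U f "\<lambda>u. - g u"] smooth_on_minus[of U g] by simp

lemma smooth_on_divide:
  fixes f g :: "'a::real_normed_vector \<Rightarrow> real"
  shows "open U \<Longrightarrow> smooth_on U f \<Longrightarrow> smooth_on U g \<Longrightarrow> (\<And>u. u \<in> U \<Longrightarrow> g u \<noteq> 0) \<Longrightarrow>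
    smooth_on U (\<lambda>u. f u / g u)"
  unfolding divide_inverse by (intro smooth_on_mult smooth_on_inverse)

lemma smooth_on_sum:
  "open U \<Longrightarrow> (\<And>i. i \<in> I \<Longrightarrow> smooth_on U (f i)) \<Longrightarrow> smooth_on U (\<lambda>u. \<Sum>i\<in>I. f i u)"
  by (induction I rule: infinite_finite_induct) (auto intro: smooth_on_const smooth_on_add)

lemmas smooth_on_intros = smooth_on_const smooth_on_add smooth_on_diff smooth_on_minus
  smooth_on_mult smooth_on_scaleR smooth_on_vec_nth smooth_on_ddir smooth_on_divide smooth_on_sum

lemma smooth_on_vec:
  assumes "open U" "\<And>i. smooth_on U (\<lambda>u. f u $ i)"
  shows "smooth_on U (f :: _ \<Rightarrow> real^'n::finite)"
proof -
  have "smooth_on U (\<lambda>u. \<Sum>i\<in>UNIV. f u $ i *\<^sub>R (axis i 1 :: real^'n))"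
    by (intro smooth_on_sum smooth_on_scaleR smooth_on_const assms)
  moreover have "(\<lambda>u. \<Sum>i\<in>UNIV. f u $ i *\<^sub>R (axis i 1 :: real^'n)) = f"
    by (rule ext) (simp add: basis_expansion[where 'a=real, unfolded scalar_mult_eq_scaleR])
  ultimately show ?thesis by simp
qed

lemma ddir_linear: "f differentiable (at u) \<Longrightarrow> linear (\<lambda>v. ddir v f u)"
  using has_derivative_frechet has_derivative_linear by blast

text \<open>Two applications of the mean value theorem express the second difference over a parallelogram
  of size \<open>h\<close> as \<open>h\<^sup>2\<close> times a mixed second derivative at a nearby point. The second difference is
  symmetric in \<open>v\<close> and \<open>w\<close>, so this yields the symmetry of mixed derivatives.\<close>

lemma second_difference_estimate:
  fixes F :: "'a::real_normed_vector \<Rightarrow> real"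
  assumes "open U" "u \<in> U" "smooth_on U F" "0 < e"
  shows "\<exists>r>0. \<forall>h. 0 < h \<and> h < r \<longrightarrow>
    \<bar>F (u + h *\<^sub>R v + h *\<^sub>R w) - F (u + h *\<^sub>R v) - F (u + h *\<^sub>R w) + F u - h\<^sup>2 * ddir w (ddir v F) u\<bar> \<le> h\<^sup>2 * e"
proof -
  let ?H = "ddir w (ddir v F)"
  obtain r0 where r0: "r0 > 0" "ball u r0 \<subseteq> U" using assms(1,2) openE by blast
  have "continuous_on U ?H"
    by (intro smooth_on_continuous_on smooth_on_ddir assms)
  then have "isCont ?H u" using assms(1,2) continuous_on_eq_continuous_at by blast
  then obtain r1 where r1: "r1 > 0" "\<And>x. dist x u < r1 \<Longrightarrow> dist (?H x) (?H u) < e"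
    using assms(4) unfolding continuous_at_eps_delta by blast
  define K where "K = norm v + norm w + 1"
  have K: "K > 0" unfolding K_def by (smt (verit) norm_ge_zero)
  \<comment> \<open>the parallelogram with sides \<open>h v\<close>, \<open>h w\<close> for \<open>h < r\<close> stays within \<open>min r0 r1\<close> of \<open>u\<close>\<close>
  define r where "r = min r0 r1 / K"
  have "r > 0" using r0 r1 K by (simp add: r_def)
  have near: "dist (u + s *\<^sub>R v + t *\<^sub>R w) u < min r0 r1" if "0 \<le> s" "s \<le> h" "0 \<le> t" "t \<le> h" "0<h" "h < r" for s t h
  proof -
    have "dist (u + s *\<^sub>R v + t *\<^sub>R w) u = norm (s *\<^sub>R v + t *\<^sub>R w)" by (simp add: dist_norm)
    also have "\<dots> \<le> s * norm v + t * norm w"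
      using norm_triangle_ineq[of "s *\<^sub>R v" "t *\<^sub>R w"] that by simp
    also have "\<dots> \<le> h * norm v + h * norm w"
      using that by (intro add_mono mult_right_mono) auto
    also have "\<dots> < h * K" using that by (simp add: K_def algebra_simps)
    also have "\<dots> < r * K" using that K by simp
    finally show ?thesis using K by (simp add: r_def)
  qed
  show ?thesis
  proof (intro exI conjI allI impI)
    show "r > 0" by fact
    fix h assume "0 < h \<and> h < r"
    then have h: "0 < h" "h < r" by auto
    have inU: "u + s *\<^sub>R v + t *\<^sub>R w \<in> U" if "0 \<le> s" "s \<le> h" "0 \<le> t" "t \<le> h" for s t
      using near[OF that h] r0 by (auto simp: dist_commute subset_eq)
    have dline: "((\<lambda>s. f (x + s *\<^sub>R y)) has_real_derivative ddir y f (x + s *\<^sub>R y)) (at s)"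
      if "smooth_on U f" "x + s *\<^sub>R y \<in> U" for f x y s
    proof -
      have *: "(f has_derivative (\<lambda>v. ddir v f (x + s *\<^sub>R y))) (at (x + s *\<^sub>R y))"
        using that smooth_on_differentiable has_derivative_frechet by blast
      have "((\<lambda>s. f (x + s *\<^sub>R y)) has_derivative (\<lambda>k. ddir (k *\<^sub>R y) f (x + s *\<^sub>R y))) (at s)"
        by (rule has_derivative_compose[of "\<lambda>s. x + s *\<^sub>R y" "\<lambda>k. k *\<^sub>R y" s UNIV, OF _ *]) (auto intro!: derivative_eq_intros)
      moreover have "ddir (k *\<^sub>R y) f (x + s *\<^sub>R y) = ddir y f (x + s *\<^sub>R y) * k" for k
        using linear_scale[OF ddir_linear[OF smooth_on_differentiable[OF that]], of k y] by simp
      ultimately show ?thesis by (simp add: has_field_derivative_def)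
    qed
    define p where "p s = F (u + h *\<^sub>R w + s *\<^sub>R v) - F (u + s *\<^sub>R v)" for s
    have "\<exists>z>0. z < h \<and> p h - p 0 = (h - 0) * (ddir v F (u + h *\<^sub>R w + z *\<^sub>R v) - ddir v F (u + z *\<^sub>R v))"
    proof (rule MVT2)
      fix s assume s: "0 \<le> s" "s \<le> h"
      show "(p has_real_derivative ddir v F (u + h *\<^sub>R w + s *\<^sub>R v) - ddir v F (u + s *\<^sub>R v)) (at s)"
        unfolding p_def using inU[of s h] inU[of s 0] s h
        by (intro DERIV_diff dline assms) (auto simp: algebra_simps)
    qed (use h in auto)
    then obtain z where z: "0 < z" "z < h"
      "p h - p 0 = h * (ddir v F (u + h *\<^sub>R w + z *\<^sub>R v) - ddir v F (u + z *\<^sub>R v))" by auto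
    have "\<exists>y>0. y < h \<and> ddir v F (u + z *\<^sub>R v + h *\<^sub>R w) - ddir v F (u + z *\<^sub>R v + 0 *\<^sub>R w) =
        (h - 0) * ?H (u + z *\<^sub>R v + y *\<^sub>R w)"
      using inU z h by (intro MVT2 dline smooth_on_ddir assms) auto
    then obtain y where y: "0 < y" "y < h"
      "ddir v F (u + z *\<^sub>R v + h *\<^sub>R w) - ddir v F (u + z *\<^sub>R v) = h * ?H (u + z *\<^sub>R v + y *\<^sub>R w)"
      by auto
    have "p h - p 0 = h\<^sup>2 * ?H (u + z *\<^sub>R v + y *\<^sub>R w)"
      using z(3) y(3) by (simp add: algebra_simps power2_eq_square)
    then have "F (u + h *\<^sub>R v + h *\<^sub>R w) - F (u + h *\<^sub>R v) - F (u + h *\<^sub>R w) + F u - h\<^sup>2 * ?H u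
       = h\<^sup>2 * (?H (u + z *\<^sub>R v + y *\<^sub>R w) - ?H u)"
      unfolding p_def by (simp add: algebra_simps)
    moreover have "\<bar>?H (u + z *\<^sub>R v + y *\<^sub>R w) - ?H u\<bar> \<le> e"
      using r1(2)[of "u + z *\<^sub>R v + y *\<^sub>R w"] near[of z h y] z y h by (auto simp: dist_real_def)
    ultimately show "\<bar>F (u + h *\<^sub>R v + h *\<^sub>R w) - F (u + h *\<^sub>R v) - F (u + h *\<^sub>R w) + F u - h\<^sup>2 * ?H u\<bar> \<le> h\<^sup>2 * e"
      by (simp add: abs_mult mult_left_mono)
  qed
qed

lemma ddir_commute_real:
  fixes F :: "'a::real_normed_vector \<Rightarrow> real"
  assumes "open U" "u \<in> U" "smooth_on U F"
  shows "ddir w (ddir v F) u = ddir v (ddir w F) u"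
proof (rule ccontr)
  define e where "e = \<bar>ddir w (ddir v F) u - ddir v (ddir w F) u\<bar> / 3"
  assume "ddir w (ddir v F) u \<noteq> ddir v (ddir w F) u"
  then have e: "e > 0" by (simp add: e_def)
  obtain r1 where r1: "r1 > 0" "\<And>h. 0 < h \<Longrightarrow> h < r1 \<Longrightarrow>
    \<bar>F (u + h *\<^sub>R v + h *\<^sub>R w) - F (u + h *\<^sub>R v) - F (u + h *\<^sub>R w) + F u - h\<^sup>2 * ddir w (ddir v F) u\<bar> \<le> h\<^sup>2 * e"
    using second_difference_estimate[OF assms e, of v w] by blast
  obtain r2 where r2: "r2 > 0" "\<And>h. 0 < h \<Longrightarrow> h < r2 \<Longrightarrow>
    \<bar>F (u + h *\<^sub>R w + h *\<^sub>R v) - F (u + h *\<^sub>R w) - F (u + h *\<^sub>R v) + F u - h\<^sup>2 * ddir v (ddir w F) u\<bar> \<le> h\<^sup>2 * e"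
    using second_difference_estimate[OF assms e, of w v] by blast
  define h where "h = min r1 r2 / 2"
  have h: "0 < h" "h < r1" "h < r2" using r1 r2 by (auto simp: h_def)
  have "\<bar>h\<^sup>2 * ddir w (ddir v F) u - h\<^sup>2 * ddir v (ddir w F) u\<bar> \<le> 2 * (h\<^sup>2 * e)"
    using r1(2)[of h] r2(2)[of h] h by (simp add: add_ac)
  then have "h\<^sup>2 * \<bar>ddir w (ddir v F) u - ddir v (ddir w F) u\<bar> \<le> h\<^sup>2 * (2 * e)"
    by (simp add: abs_mult flip: right_diff_distrib)
  then have "\<bar>ddir w (ddir v F) u - ddir v (ddir w F) u\<bar> \<le> 2 * e" using h by simp
  then show False using e by (simp add: e_def)
qed

lemma ddir_nth:
  fixes f :: "'a::real_normed_vector \<Rightarrow> real^'n::finite"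
  assumes "f differentiable (at u)"
  shows "ddir v (\<lambda>x. f x $ i) u = ddir v f u $ i"
  using bounded_linear.has_derivative[OF bounded_linear_vec_nth has_derivative_frechet[OF assms], of i]
  by (metis frechet_derivative_at)

lemma ddir_commute:
  fixes f :: "'a::real_normed_vector \<Rightarrow> real^'n::finite"
  assumes "open U" "u \<in> U" "smooth_on U f"
  shows "ddir w (ddir v f) u = ddir v (ddir w f) u"
proof -
  have "ddir w (ddir v f) u $ i = ddir w (ddir v (\<lambda>x. f x $ i)) u" for v w i
  proof -
    have "ddir w (ddir v f) u $ i = ddir w (\<lambda>x. ddir v f x $ i) u"
      using assms by (intro ddir_nth[symmetric] smooth_on_differentiable smooth_on_ddir)
    also have "\<dots> = ddir w (ddir v (\<lambda>x. f x $ i)) u"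
      by (rule fun_cong[OF frechet_derivative_cong_on[OF assms(1,2)]])
        (rule ddir_nth[OF smooth_on_differentiable[OF assms(3)], symmetric])
    finally show ?thesis .
  qed
  then show ?thesis
    using ddir_commute_real[OF assms(1,2) smooth_on_vec_nth[OF assms(1,3)]] by (simp add: vec_eq_iff)
qed

lemma ddir_expand:
  fixes f :: "real^'m::finite \<Rightarrow> 'b::real_normed_vector"
  assumes "f differentiable (at u)"
  shows "ddir v f u = (\<Sum>i\<in>UNIV. v $ i *\<^sub>R ddir (axis i 1) f u)"
proof -
  have "ddir v f u = ddir (\<Sum>i\<in>UNIV. v $ i *\<^sub>R axis i 1) f u"
    by (simp add: basis_expansion[where 'a=real, unfolded scalar_mult_eq_scaleR])
  then show ?thesis
    by (simp add: linear_sum[OF ddir_linear[OF assms]] linear_scale[OF ddir_linear[OF assms]])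
qed

lemma Ck_on_compose:
  fixes f :: "real^'n::finite \<Rightarrow> 'b::real_normed_vector"
    and \<phi> :: "'a::real_normed_vector \<Rightarrow> real^'n"
  assumes "open W" "\<phi> ` W \<subseteq> U" "smooth_on U f" "smooth_on W \<phi>"
  shows "Ck_on k W (\<lambda>u. f (\<phi> u))"
  using assms(3)
proof (induction k arbitrary: f)
  case 0
  show ?case
    using continuous_on_compose2[OF smooth_on_continuous_on[OF 0] smooth_on_continuous_on[OF assms(4)]
        assms(2)] by simp
next
  case (Suc k)
  let ?D = "\<lambda>v u. \<Sum>i\<in>UNIV. ddir v \<phi> u $ i *\<^sub>R ddir (axis i 1) f (\<phi> u)"
  show ?case
  proof (rule Ck_on_SucI[OF assms(1), where D = ?D])
    fix u assume u: "u \<in> W"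
    then have d: "f differentiable (at (\<phi> u))" "\<phi> differentiable (at u)"
      using assms Suc.prems smooth_on_differentiable by blast+
    show "((\<lambda>u. f (\<phi> u)) has_derivative (\<lambda>v. ?D v u)) (at u)"
      unfolding ddir_expand[OF d(1), of "ddir _ \<phi> u", symmetric]
      by (rule has_derivative_compose[OF has_derivative_frechet[OF d(2)] has_derivative_frechet[OF d(1)]])
  next
    fix v
    have s: "smooth_on W (\<lambda>u. ddir v \<phi> u $ i)" for i
      by (intro smooth_on_vec_nth smooth_on_ddir assms)
    have "Ck_on k W (\<lambda>u. \<Sum>i\<in>I. ddir v \<phi> u $ i *\<^sub>R ddir (axis i 1) f (\<phi> u))" for I
    proof (induction I rule: infinite_finite_induct)
      case (insert i I)
      have "Ck_on k W (\<lambda>u. ddir v \<phi> u $ i *\<^sub>R ddir (axis i 1) f (\<phi> u))"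
        using s by (intro Ck_on_bilinear[OF bounded_bilinear_scaleR assms(1)] Suc.IH smooth_on_ddir Suc.prems)
          (simp add: smooth_on_def)
      with insert show ?case by (simp add: Ck_on_add[OF assms(1)])
    qed (simp_all add: Ck_on_const)
    then show "Ck_on k W (?D v)" .
  qed
qed

lemma smooth_on_compose:
  fixes f :: "real^'n::finite \<Rightarrow> 'b::real_normed_vector"
  assumes "open W" "\<phi> ` W \<subseteq> U" "smooth_on U f" "smooth_on W \<phi>"
  shows "smooth_on W (\<lambda>u. f (\<phi> u))"
  using Ck_on_compose[OF assms] by (simp add: smooth_on_def)

lemma ddir_scaleR:
  assumes "f differentiable (at u)" "g differentiable (at u)"
  shows "ddir w (\<lambda>x. f x *\<^sub>R g x) u = f u *\<^sub>R ddir w g u + ddir w f u *\<^sub>R g u"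
  by (rule fun_cong[OF frechet_derivative_at[OF has_derivative_scaleR[OF assms[THEN has_derivative_frechet]]], symmetric])

lemma ddir_add:
  assumes "f differentiable (at u)" "g differentiable (at u)"
  shows "ddir w (\<lambda>x. f x + g x) u = ddir w f u + ddir w g u"
  by (rule fun_cong[OF frechet_derivative_at[OF has_derivative_add[OF assms[THEN has_derivative_frechet]]], symmetric])

lemma ddir_const_on:
  assumes "open U" "u \<in> U" "\<And>x. x \<in> U \<Longrightarrow> f x = k"
  shows "ddir v f u = 0"
  using fun_cong[OF frechet_derivative_cong_on[OF assms(1,2), of f "\<lambda>_. k"], of v] assms(3) by simp

lemma has_derivative_const_on:
  assumes "(f has_derivative f') (at u)" "open U" "u \<in> U" "\<And>x. x \<in> U \<Longrightarrow> f x = k"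
  shows "f' w = 0"
  using ddir_const_on[where f = f and k = k and v = w, OF assms(2-4)] frechet_derivative_at[OF assms(1)] by simp

text \<open>The product rule for a family of linear maps applied to a moving vector. It is used for the
  differential of an immersion, for the Christoffel form and for 1-forms.\<close>

lemma has_derivative_linear_family:
  fixes Y :: "'a::real_normed_vector \<Rightarrow> real^'n::finite"
  assumes "open U" "u \<in> U" "\<And>q. q \<in> U \<Longrightarrow> linear (F q)"
    and dF: "\<And>i. (\<lambda>q. F q (axis i 1)) differentiable (at u)" and dY: "Y differentiable (at u)"
  shows "((\<lambda>q. F q (Y q)) has_derivative (\<lambda>w. ddir w (\<lambda>q. F q (Y u)) u + F u (ddir w Y u))) (at u)"
proof -
  have expand: "F q y = (\<Sum>i\<in>UNIV. y $ i *\<^sub>R F q (axis i 1))" if "q \<in> U" for q y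
  proof -
    have "F q y = F q (\<Sum>i\<in>UNIV. y $ i *\<^sub>R axis i 1)"
      by (simp add: basis_expansion[where 'a=real, unfolded scalar_mult_eq_scaleR])
    then show ?thesis by (simp add: linear_sum[OF assms(3)[OF that]] linear_scale[OF assms(3)[OF that]])
  qed
  have gen: "((\<lambda>q. F q (Z q)) has_derivative (\<lambda>w. \<Sum>i\<in>UNIV. Z u $ i *\<^sub>R ddir w (\<lambda>q. F q (axis i 1)) u
        + ddir w Z u $ i *\<^sub>R F u (axis i 1))) (at u)"
    if "Z differentiable (at u)" for Z :: "'a \<Rightarrow> real^'n"
  proof -
    have "((\<lambda>q. \<Sum>i\<in>UNIV. Z q $ i *\<^sub>R F q (axis i 1)) has_derivative
      (\<lambda>w. \<Sum>i\<in>UNIV. Z u $ i *\<^sub>R ddir w (\<lambda>q. F q (axis i 1)) u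
        + ddir w Z u $ i *\<^sub>R F u (axis i 1))) (at u)"
      by (intro has_derivative_sum has_derivative_scaleR has_derivative_frechet dF
        bounded_linear.has_derivative[OF bounded_linear_vec_nth] that)
    then show ?thesis
      by (rule has_derivative_transform_within_open[OF _ assms(1,2)]) (rule expand[symmetric])
  qed
  have const: "ddir w (\<lambda>q. F q (Y u)) u = (\<Sum>i\<in>UNIV. Y u $ i *\<^sub>R ddir w (\<lambda>q. F q (axis i 1)) u)" for w
    using fun_cong[OF frechet_derivative_at[OF gen[of "\<lambda>_. Y u"]], of w] by simp
  show ?thesis
    using gen[OF dY] unfolding const expand[OF assms(2), of "ddir _ Y u"] by (simp add: sum.distrib)
qed

lemma ddir_linear_family:
  fixes Y :: "'a::real_normed_vector \<Rightarrow> real^'n::finite"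
  assumes "open U" "u \<in> U" "\<And>q. q \<in> U \<Longrightarrow> linear (F q)"
    and "\<And>i. (\<lambda>q. F q (axis i 1)) differentiable (at u)" and "Y differentiable (at u)"
  shows "ddir w (\<lambda>q. F q (Y q)) u = ddir w (\<lambda>q. F q (Y u)) u + F u (ddir w Y u)"
  using fun_cong[OF frechet_derivative_at[OF has_derivative_linear_family[OF assms]], of w] by simp

section \<open>Metrics and their Levi-Civita connections\<close>

lemma bilinear_expand:
  fixes B :: "real^'n::finite \<Rightarrow> real^'m::finite \<Rightarrow> real"
  assumes "bilinear B"
  shows "B y z = (\<Sum>i\<in>UNIV. \<Sum>j\<in>UNIV. y $ i * z $ j * B (axis i 1) (axis j 1))"
proof -
  have "B y z = B (\<Sum>i\<in>UNIV. y $ i *\<^sub>R axis i 1) (\<Sum>j\<in>UNIV. z $ j *\<^sub>R axis j 1)"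
    by (simp add: basis_expansion[where 'a=real, unfolded scalar_mult_eq_scaleR])
  also have "\<dots> = (\<Sum>(i,j)\<in>UNIV \<times> UNIV. B (y $ i *\<^sub>R axis i 1) (z $ j *\<^sub>R axis j 1))"
    by (rule bilinear_sum[OF assms])
  also have "\<dots> = (\<Sum>i\<in>UNIV. \<Sum>j\<in>UNIV. y $ i * z $ j * B (axis i 1) (axis j 1))"
    by (simp add: sum.cartesian_product bilinear_lmul[OF assms] bilinear_rmul[OF assms] mult_ac)
  finally show ?thesis .
qed

lemma christoffel_form_bilinear: "bilinear (christoffel_form G p)"
  by (auto simp: bilinear_def christoffel_form_def vec_eq_iff algebra_simps sum.distrib
      sum_distrib_left intro!: linearI)

lemma cov_along_id: "cov_along G (\<lambda>q. q) u w Y = ddir w Y u + christoffel_form G u w (Y u)"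
  by (simp add: cov_along_def)

text \<open>Bilinearity and nondegeneracy are required on \<open>U\<close> only, because the metric induced by a
  parametrization has these properties only on its domain.\<close>

locale pseudo_metric =
  fixes U :: "(real^'n::finite) set" and G :: "'n metric"
  assumes open_U: "open U"
    and bilinear_G: "\<And>q. q \<in> U \<Longrightarrow> bilinear (G q)"
    and sym_G: "\<And>q y z. q \<in> U \<Longrightarrow> G q y z = G q z y"
    and nondegenerate: "\<And>q y. q \<in> U \<Longrightarrow> (\<And>z. G q y z = 0) \<Longrightarrow> y = 0"
    and smooth_G: "\<And>y z. smooth_on U (\<lambda>q. G q y z)"
begin

lemma nondegenerate_eq:
  assumes "q \<in> U" "\<And>z. G q x z = G q y z"
  shows "x = y"
  using nondegenerate[OF assms(1), of "x - y"] assms(2) bilinear_lsub[OF bilinear_G[OF assms(1)]] by simp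

lemma diff_G: "q \<in> U \<Longrightarrow> (\<lambda>q. G q y z) differentiable (at q)"
  using smooth_G smooth_on_differentiable by blast

lemma G_matrix:
  assumes "q \<in> U"
  shows "G q y z = y \<bullet> (metric_matrix G q *v z)"
  by (subst bilinear_expand[OF bilinear_G[OF assms]])
    (simp add: inner_vec_def matrix_vector_mult_def metric_matrix_def sum_distrib_left mult_ac)

lemma invertible_metric_matrix:
  assumes "q \<in> U"
  shows "invertible (metric_matrix G q)"
proof -
  have "y = 0" if "metric_matrix G q *v y = 0" for y
    using nondegenerate[OF assms, of y] that sym_G[OF assms, of y] G_matrix[OF assms] by simp
  then show ?thesis by (simp add: invertible_left_inverse matrix_left_invertible_ker)
qed

lemma ddir_G:
  assumes p: "p \<in> U"
  shows "ddir x (\<lambda>q. G q y z) p =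
    (\<Sum>i\<in>UNIV. \<Sum>j\<in>UNIV. \<Sum>l\<in>UNIV. x $ i * y $ j * z $ l * partial_deriv i (\<lambda>q. metric_matrix G q $ j $ l) p)"
proof -
  have e: "ddir x (\<lambda>q. G q (axis j 1) (axis l 1)) p
      = (\<Sum>i\<in>UNIV. x $ i * partial_deriv i (\<lambda>q. metric_matrix G q $ j $ l) p)" for j l
    using ddir_expand[OF diff_G[OF p, of "axis j 1" "axis l 1"], of x] by (simp add: partial_deriv_def metric_matrix_def)
  have "((\<lambda>q. \<Sum>j\<in>UNIV. \<Sum>l\<in>UNIV. y $ j * z $ l * G q (axis j 1) (axis l 1)) has_derivative
      (\<lambda>v. \<Sum>j\<in>UNIV. \<Sum>l\<in>UNIV. y $ j * z $ l * ddir v (\<lambda>q. G q (axis j 1) (axis l 1)) p)) (at p)"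
    by (intro has_derivative_sum has_derivative_mult_right has_derivative_frechet diff_G p)
  then have "ddir x (\<lambda>q. \<Sum>j\<in>UNIV. \<Sum>l\<in>UNIV. y $ j * z $ l * G q (axis j 1) (axis l 1)) p =
      (\<Sum>j\<in>UNIV. \<Sum>l\<in>UNIV. y $ j * z $ l * ddir x (\<lambda>q. G q (axis j 1) (axis l 1)) p)"
    by (metis (no_types, lifting) frechet_derivative_at)
  also have "ddir x (\<lambda>q. \<Sum>j\<in>UNIV. \<Sum>l\<in>UNIV. y $ j * z $ l * G q (axis j 1) (axis l 1)) p
      = ddir x (\<lambda>q. G q y z) p"
    by (rule fun_cong[OF frechet_derivative_cong_on[OF open_U p]])
      (rule bilinear_expand[OF bilinear_G, symmetric])
    finally have "ddir x (\<lambda>q. G q y z) p = (\<Sum>j\<in>UNIV. \<Sum>l\<in>UNIV. \<Sum>i\<in>UNIV.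
      x $ i * y $ j * z $ l * partial_deriv i (\<lambda>q. metric_matrix G q $ j $ l) p)"
    by (simp add: e sum_distrib_left mult_ac)
  also have "\<dots> = (\<Sum>j\<in>UNIV. \<Sum>i\<in>UNIV. \<Sum>l\<in>UNIV.
      x $ i * y $ j * z $ l * partial_deriv i (\<lambda>q. metric_matrix G q $ j $ l) p)"
    by (rule sum.cong[OF refl], rule sum.swap)
  also have "\<dots> = (\<Sum>i\<in>UNIV. \<Sum>j\<in>UNIV. \<Sum>l\<in>UNIV.
      x $ i * y $ j * z $ l * partial_deriv i (\<lambda>q. metric_matrix G q $ j $ l) p)"
    by (rule sum.swap)
  finally show ?thesis .
qed

text \<open>Lowering the index of the Christoffel symbols cancels the inverse matrix in their definition.
  As the metric is nondegenerate, this equation determines the Christoffel form; the connection is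
  handled through it from here on.\<close>

lemma koszul:
  assumes p: "p \<in> U"
  shows "2 * G p (christoffel_form G p x y) z =
    ddir x (\<lambda>q. G q y z) p + ddir y (\<lambda>q. G q x z) p - ddir z (\<lambda>q. G q x y) p"
proof -
  define B where "B i j l = partial_deriv i (\<lambda>q. metric_matrix G q $ j $ l) p" for i j l
  define g where "g = metric_matrix G p"
  define a where "a = (\<chi> l. \<Sum>i\<in>UNIV. \<Sum>j\<in>UNIV. (B i j l + B j i l - B l i j) * x $ i * y $ j)"
  have inv: "g ** matrix_inv g = mat 1"
    using someI_ex[OF invertible_metric_matrix[OF p, unfolded invertible_def]]
    by (simp add: matrix_inv_def g_def)
  have "christoffel_form G p x y $ k = ((1/2) *\<^sub>R (matrix_inv g *v a)) $ k" for k
  proof -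
    have "christoffel_form G p x y $ k = (\<Sum>i\<in>UNIV. \<Sum>j\<in>UNIV. \<Sum>l\<in>UNIV.
       (1/2) * (matrix_inv g $ k $ l * ((B i j l + B j i l - B l i j) * x $ i * y $ j)))"
      unfolding christoffel_form_def christoffel_def g_def B_def
      by (simp add: sum_distrib_left sum_distrib_right sum_divide_distrib mult_ac)
    also have "\<dots> = (\<Sum>i\<in>UNIV. \<Sum>l\<in>UNIV. \<Sum>j\<in>UNIV.
       (1/2) * (matrix_inv g $ k $ l * ((B i j l + B j i l - B l i j) * x $ i * y $ j)))"
      by (rule sum.cong[OF refl], rule sum.swap)
    also have "\<dots> = (\<Sum>l\<in>UNIV. \<Sum>i\<in>UNIV. \<Sum>j\<in>UNIV.
       (1/2) * (matrix_inv g $ k $ l * ((B i j l + B j i l - B l i j) * x $ i * y $ j)))"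
      by (rule sum.swap)
    finally show ?thesis
      by (simp add: a_def matrix_vector_mult_def sum_distrib_left)
  qed
  then have \<Gamma>: "christoffel_form G p x y = (1/2) *\<^sub>R (matrix_inv g *v a)" by (simp add: vec_eq_iff)
  have "G p (christoffel_form G p x y) z = z \<bullet> (g *v ((1/2) *\<^sub>R (matrix_inv g *v a)))"
    using G_matrix[OF p] sym_G[OF p] by (simp add: g_def \<Gamma>)
  also have "\<dots> = (z \<bullet> a) / 2"
    by (simp add: matrix_vector_mult_scaleR matrix_vector_mul_assoc inv)
  finally have "2 * G p (christoffel_form G p x y) z = z \<bullet> a" by simp
  also have "\<dots> = (\<Sum>l\<in>UNIV. \<Sum>i\<in>UNIV. \<Sum>j\<in>UNIV. x $ i * y $ j * z $ l * (B i j l + B j i l - B l i j))"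
    by (simp add: a_def inner_vec_def sum_distrib_left mult_ac)
  also have "\<dots> = (\<Sum>l\<in>UNIV. \<Sum>i\<in>UNIV. \<Sum>j\<in>UNIV. x $ i * y $ j * z $ l * B i j l)
     + (\<Sum>l\<in>UNIV. \<Sum>i\<in>UNIV. \<Sum>j\<in>UNIV. x $ i * y $ j * z $ l * B j i l)
     - (\<Sum>l\<in>UNIV. \<Sum>i\<in>UNIV. \<Sum>j\<in>UNIV. x $ i * y $ j * z $ l * B l i j)"
    by (simp add: distrib_left right_diff_distrib sum.distrib sum_subtractf)
  also have "(\<Sum>l\<in>UNIV. \<Sum>i\<in>UNIV. \<Sum>j\<in>UNIV. x $ i * y $ j * z $ l * B i j l)
    = (\<Sum>i\<in>UNIV. \<Sum>j\<in>UNIV. \<Sum>l\<in>UNIV. x $ i * y $ j * z $ l * B i j l)"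
    by (subst sum.swap, rule sum.cong[OF refl], rule sum.swap)
  also have "(\<Sum>l\<in>UNIV. \<Sum>i\<in>UNIV. \<Sum>j\<in>UNIV. x $ i * y $ j * z $ l * B j i l)
    = (\<Sum>i\<in>UNIV. \<Sum>j\<in>UNIV. \<Sum>l\<in>UNIV. y $ i * x $ j * z $ l * B i j l)"
  proof -
    have "(\<Sum>l\<in>UNIV. \<Sum>i\<in>UNIV. \<Sum>j\<in>UNIV. x $ i * y $ j * z $ l * B j i l)
      = (\<Sum>l\<in>UNIV. \<Sum>j\<in>UNIV. \<Sum>i\<in>UNIV. x $ i * y $ j * z $ l * B j i l)"
      by (rule sum.cong[OF refl], rule sum.swap)
    also have "\<dots> = (\<Sum>j\<in>UNIV. \<Sum>i\<in>UNIV. \<Sum>l\<in>UNIV. x $ i * y $ j * z $ l * B j i l)"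
      by (subst sum.swap, rule sum.cong[OF refl], rule sum.swap)
    finally show ?thesis by (simp add: mult_ac)
  qed
  also have "(\<Sum>l\<in>UNIV. \<Sum>i\<in>UNIV. \<Sum>j\<in>UNIV. x $ i * y $ j * z $ l * B l i j)
    = (\<Sum>i\<in>UNIV. \<Sum>j\<in>UNIV. \<Sum>l\<in>UNIV. z $ i * x $ j * y $ l * B i j l)"
    by (simp add: mult_ac)
  finally show ?thesis by (simp only: ddir_G[OF p] B_def)
qed

lemma christoffel_form_sym: "p \<in> U \<Longrightarrow> christoffel_form G p x y = christoffel_form G p y x"
  using koszul[of p x y] koszul[of p y x]
    frechet_derivative_cong_on[OF open_U, of p "\<lambda>q. G q y x" "\<lambda>q. G q x y"] sym_G[of _ y x]
  by (intro nondegenerate_eq[of p]) (simp, smt (verit))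

lemma metric_compatible:
  assumes p: "p \<in> U"
  shows "ddir x (\<lambda>q. G q y z) p = G p (christoffel_form G p x y) z + G p y (christoffel_form G p x z)"
proof -
  have "ddir v (\<lambda>q. G q b a) p = ddir v (\<lambda>q. G q a b) p" for v a b
    by (rule fun_cong[OF frechet_derivative_cong_on[OF open_U p]]) (rule sym_G)
  then show ?thesis
    using koszul[OF p, of x y z] koszul[OF p, of x z y] sym_G[OF p, of y] by fastforce
qed

text \<open>Compatibility of the connection with the metric, for vector fields along a map \<open>\<phi>\<close>.\<close>

lemma ddir_metric_along:
  fixes \<phi> V W :: "real^'m::finite \<Rightarrow> real^'n"
  assumes S: "open S" "u \<in> S" "\<phi> ` S \<subseteq> U"
    and d: "\<phi> differentiable (at u)" "V differentiable (at u)" "W differentiable (at u)"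
  shows "ddir w (\<lambda>u. G (\<phi> u) (V u) (W u)) u
    = G (\<phi> u) (cov_along G \<phi> u w V) (W u) + G (\<phi> u) (V u) (cov_along G \<phi> u w W)"
proof -
  have p: "\<phi> u \<in> U" using S by auto
  note bil = bilinear_G[OF p]
  let ?g = "\<lambda>i j q. G q (axis i 1) (axis j 1)"
  have comp: "((\<lambda>u. ?g i j (\<phi> u)) has_derivative (\<lambda>v. ddir (ddir v \<phi> u) (?g i j) (\<phi> u))) (at u)" for i j
    by (rule has_derivative_compose[OF has_derivative_frechet[OF d(1)] has_derivative_frechet[OF diff_G[OF p]]])
  have nth: "((\<lambda>u. X u $ i) has_derivative (\<lambda>v. ddir v X u $ i)) (at u)"
    if "X differentiable (at u)" for X :: "real^'m \<Rightarrow> real^'n" and i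
    by (rule bounded_linear.has_derivative[OF bounded_linear_vec_nth has_derivative_frechet[OF that]])
  have "((\<lambda>u. \<Sum>i\<in>UNIV. \<Sum>j\<in>UNIV. V u $ i * W u $ j * ?g i j (\<phi> u)) has_derivative
     (\<lambda>v. \<Sum>i\<in>UNIV. \<Sum>j\<in>UNIV. (V u $ i * W u $ j) * ddir (ddir v \<phi> u) (?g i j) (\<phi> u)
        + (V u $ i * ddir v W u $ j + ddir v V u $ i * W u $ j) * ?g i j (\<phi> u))) (at u)"
    by (intro has_derivative_sum has_derivative_mult comp nth d)
  then have "ddir w (\<lambda>u. \<Sum>i\<in>UNIV. \<Sum>j\<in>UNIV. V u $ i * W u $ j * ?g i j (\<phi> u)) u
     = (\<Sum>i\<in>UNIV. \<Sum>j\<in>UNIV. (V u $ i * W u $ j) * ddir (ddir w \<phi> u) (?g i j) (\<phi> u)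
        + (V u $ i * ddir w W u $ j + ddir w V u $ i * W u $ j) * ?g i j (\<phi> u))"
    by (metis (no_types, lifting) frechet_derivative_at)
  moreover have "ddir w (\<lambda>u. \<Sum>i\<in>UNIV. \<Sum>j\<in>UNIV. V u $ i * W u $ j * ?g i j (\<phi> u)) u
     = ddir w (\<lambda>u. G (\<phi> u) (V u) (W u)) u"
    using S(3) by (intro fun_cong[OF frechet_derivative_cong_on[OF S(1,2)]]
        bilinear_expand[OF bilinear_G, symmetric]) auto
  ultimately have "ddir w (\<lambda>u. G (\<phi> u) (V u) (W u)) u
     = (\<Sum>i\<in>UNIV. \<Sum>j\<in>UNIV. V u $ i * W u $ j * ddir (ddir w \<phi> u) (?g i j) (\<phi> u))
       + (\<Sum>i\<in>UNIV. \<Sum>j\<in>UNIV. V u $ i * ddir w W u $ j * ?g i j (\<phi> u))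
       + (\<Sum>i\<in>UNIV. \<Sum>j\<in>UNIV. ddir w V u $ i * W u $ j * ?g i j (\<phi> u))"
    by (simp add: distrib_right sum.distrib)
  also have "(\<Sum>i\<in>UNIV. \<Sum>j\<in>UNIV. V u $ i * W u $ j * ddir (ddir w \<phi> u) (?g i j) (\<phi> u))
     = ddir (ddir w \<phi> u) (\<lambda>q. G q (V u) (W u)) (\<phi> u)"
  proof -
    have b: "bilinear (\<lambda>y z. ddir (ddir w \<phi> u) (\<lambda>q. G q y z) (\<phi> u))"
      unfolding metric_compatible[OF p] bilinear_def
      by (auto intro!: linearI simp: bilinear_ladd[OF bil] bilinear_radd[OF bil] bilinear_lmul[OF bil]
        bilinear_rmul[OF bil] bilinear_ladd[OF christoffel_form_bilinear]
        bilinear_radd[OF christoffel_form_bilinear] bilinear_lmul[OF christoffel_form_bilinear]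
        bilinear_rmul[OF christoffel_form_bilinear] algebra_simps)
    show ?thesis by (rule bilinear_expand[OF b, symmetric])
  qed
  also have "(\<Sum>i\<in>UNIV. \<Sum>j\<in>UNIV. V u $ i * ddir w W u $ j * ?g i j (\<phi> u)) = G (\<phi> u) (V u) (ddir w W u)"
    by (rule bilinear_expand[OF bil, symmetric])
  also have "(\<Sum>i\<in>UNIV. \<Sum>j\<in>UNIV. ddir w V u $ i * W u $ j * ?g i j (\<phi> u)) = G (\<phi> u) (ddir w V u) (W u)"
    by (rule bilinear_expand[OF bil, symmetric])
  finally show ?thesis
    by (simp add: cov_along_def metric_compatible[OF p] bilinear_ladd[OF bil] bilinear_radd[OF bil])
qed

end

lemma christoffel_form_simps:
  "christoffel_form G p (x + x') y = christoffel_form G p x y + christoffel_form G p x' y"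
  "christoffel_form G p x (y + y') = christoffel_form G p x y + christoffel_form G p x y'"
  "christoffel_form G p (c *\<^sub>R x) y = c *\<^sub>R christoffel_form G p x y"
  "christoffel_form G p x (c *\<^sub>R y) = c *\<^sub>R christoffel_form G p x y"
  "christoffel_form G p 0 y = 0"
  using christoffel_form_bilinear[of G p]
  by (simp_all add: bilinear_ladd bilinear_radd bilinear_lmul bilinear_rmul bilinear_lzero)

lemma riemann_const_fields:
  assumes "Z differentiable (at p)"
  shows "riemann G (\<lambda>_. x) (\<lambda>_. y) Z p =
    cov_along G (\<lambda>q. q) p x (\<lambda>q. cov_along G (\<lambda>q. q) q y Z)
    - cov_along G (\<lambda>q. q) p y (\<lambda>q. cov_along G (\<lambda>q. q) q x Z)"
proof -
  have "ddir 0 Z p = 0" using linear_0[OF ddir_linear[OF assms]] .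
  moreover have "lie_bracket (\<lambda>_. x) (\<lambda>_. y) = (\<lambda>_. 0)"
    by (simp add: fun_eq_iff lie_bracket_def)
  ultimately have zero: "levi_civita G (lie_bracket (\<lambda>_. x) (\<lambda>_. y)) Z p = 0"
    by (simp add: levi_civita_def cov_along_id christoffel_form_simps)
  have L: "levi_civita G (\<lambda>_. w) Y = (\<lambda>q. cov_along G (\<lambda>q. q) q w Y)" for w Y
    by (rule ext) (simp add: levi_civita_def)
  show ?thesis unfolding riemann_def zero L[of x] L[of y] by simp
qed

text \<open>In this expression \<open>Z\<close> enters through its value at \<open>p\<close> alone: the second derivatives of \<open>Z\<close>
  cancel by symmetry, the first derivatives because they occur symmetrically in \<open>x\<close> and \<open>y\<close>. So the
  curvature is a tensor in its last argument.\<close>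

lemma riemann_coordinate:
  assumes "open U" "p \<in> U"
    and \<Gamma>: "\<And>y z. smooth_on U (\<lambda>q. christoffel_form G q y z)" and Z: "smooth_on U Z"
  shows "riemann G (\<lambda>_. x) (\<lambda>_. y) Z p =
    ddir x (\<lambda>q. christoffel_form G q y (Z p)) p - ddir y (\<lambda>q. christoffel_form G q x (Z p)) p
    + christoffel_form G p x (christoffel_form G p y (Z p))
    - christoffel_form G p y (christoffel_form G p x (Z p))"
proof -
  note d = smooth_on_differentiable[OF _ assms(2)]
  have lin: "linear (christoffel_form G q v)" for q v
    using christoffel_form_bilinear by (auto simp: bilinear_def)
  note h = has_derivative_linear_family[OF assms(1,2) lin d[OF \<Gamma>] d[OF Z]]
  have "ddir v (\<lambda>q. cov_along G (\<lambda>q. q) q w Z) p =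
      ddir v (ddir w Z) p + (ddir v (\<lambda>q. christoffel_form G q w (Z p)) p
        + christoffel_form G p w (ddir v Z p))" for v w
  proof -
    have "(\<lambda>q. christoffel_form G q w (Z q)) differentiable (at p)"
      using h[of w] unfolding differentiable_def by blast
    then show ?thesis
      unfolding cov_along_id
      by (simp only: ddir_add[OF d[OF smooth_on_ddir[OF Z]]]
        ddir_linear_family[where F = "\<lambda>q. christoffel_form G q w", OF assms(1,2) lin d[OF \<Gamma>] d[OF Z]])
  qed
  then show ?thesis
    using ddir_commute[OF assms(1,2) Z, of x y]
    by (simp add: riemann_const_fields[OF d[OF Z]] cov_along_id[of G p] cov_along_id[of G p _ Z]
        christoffel_form_simps)
qed

lemma riemann_linear:
  assumes "open U" "p \<in> U" and \<Gamma>: "\<And>y z. smooth_on U (\<lambda>q. christoffel_form G q y z)"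
  shows "linear (\<lambda>z. riemann G (\<lambda>_. x) (\<lambda>_. y) (\<lambda>_. z) p)"
proof -
  note R = riemann_coordinate[OF assms smooth_on_const, of x y]
  note d = smooth_on_differentiable[OF \<Gamma> assms(2)]
  have c: "ddir v (\<lambda>q. c *\<^sub>R christoffel_form G q w z) p = c *\<^sub>R ddir v (\<lambda>q. christoffel_form G q w z) p" for v w z c
    by (rule fun_cong[OF frechet_derivative_at[OF has_derivative_scaleR_right[OF has_derivative_frechet[OF d]]], symmetric])
  show ?thesis
    unfolding R
    by (rule linearI) (simp_all add: christoffel_form_simps ddir_add[OF d d] c algebra_simps)
qed

lemma vec2_expand: "(x::real^2) = x$1 *\<^sub>R axis 1 1 + x$2 *\<^sub>R axis 2 1"
  by (simp add: vec_eq_iff forall_2 axis_def)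

locale surface_metric = pseudo_metric U h for U :: "(real^2) set" and h
begin

lemma h_expand:
  assumes "u \<in> U"
  shows "h u x y = x$1 * y$1 * h u (axis 1 1) (axis 1 1)
    + (x$1 * y$2 + x$2 * y$1) * h u (axis 1 1) (axis 2 1) + x$2 * y$2 * h u (axis 2 1) (axis 2 1)"
  using sym_G[OF assms, of "axis 2 1" "axis 1 1"]
  by (subst bilinear_expand[OF bilinear_G[OF assms]]) (simp add: sum_2 algebra_simps)

lemma gram_nonzero:
  assumes u: "u \<in> U"
  shows "h u (axis 1 1) (axis 1 1) * h u (axis 2 1) (axis 2 1) - (h u (axis 1 1) (axis 2 1))\<^sup>2 \<noteq> 0"
proof
  assume det: "h u (axis 1 1) (axis 1 1) * h u (axis 2 1) (axis 2 1) - (h u (axis 1 1) (axis 2 1))\<^sup>2 = 0"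
  define A B C where "A = h u (axis 1 1) (axis 1 1)" and "B = h u (axis 1 1) (axis 2 1)"
    and "C = h u (axis 2 1) (axis 2 1)"
  have AC: "A * C = B * B" using det by (simp add: A_def B_def C_def power2_eq_square)
  have ex: "h u x y = x$1 * y$1 * A + (x$1 * y$2 + x$2 * y$1) * B + x$2 * y$2 * C" for x y
    using h_expand[OF u, of x y] by (simp only: A_def B_def C_def)
  have "vector [C, - B] = (0::real^2)"
    by (rule nondegenerate[OF u]) (use AC in \<open>simp add: ex algebra_simps\<close>)
  then have "B = 0" "C = 0" by (simp_all add: vec_eq_iff forall_2)
  then have "axis 2 1 = (0::real^2)"
    by (intro nondegenerate[OF u]) (simp add: ex axis_def)
  then show False by (simp add: axis_eq_0_iff)
qed

text \<open>Cramer's rule: a vector field is smooth once its inner products with constant fields are.\<close>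

lemma smooth_on_solve:
  assumes "\<And>z. smooth_on U (\<lambda>u. h u (w u) z)"
  shows "smooth_on U w"
proof -
  let ?A = "\<lambda>u. h u (axis 1 1) (axis 1 1)" and ?B = "\<lambda>u. h u (axis 1 1) (axis 2 1)"
    and ?C = "\<lambda>u. h u (axis 2 1) (axis 2 1)"
  let ?d = "\<lambda>u. ?A u * ?C u - (?B u)\<^sup>2"
  have d: "smooth_on U ?d"
    unfolding power2_eq_square by (intro smooth_on_intros open_U smooth_G)
  have F: "h u (w u) (axis 1 1) = w u $ 1 * ?A u + w u $ 2 * ?B u"
    "h u (w u) (axis 2 1) = w u $ 1 * ?B u + w u $ 2 * ?C u" if "u \<in> U" for u
    by (simp_all add: h_expand[OF that, of "w u"] axis_def)
  have "smooth_on U (\<lambda>u. (h u (w u) (axis 1 1) * ?C u - h u (w u) (axis 2 1) * ?B u) / ?d u)"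
    by (intro smooth_on_divide d gram_nonzero) (intro smooth_on_intros open_U smooth_G assms)+
  then have w1: "smooth_on U (\<lambda>u. w u $ 1)"
    by (rule smooth_on_cong[OF open_U, rotated])
      (use gram_nonzero in \<open>simp add: F field_simps power2_eq_square\<close>)
  have "smooth_on U (\<lambda>u. (h u (w u) (axis 2 1) * ?A u - h u (w u) (axis 1 1) * ?B u) / ?d u)"
    by (intro smooth_on_divide d gram_nonzero) (intro smooth_on_intros open_U smooth_G assms)+
  then have w2: "smooth_on U (\<lambda>u. w u $ 2)"
    by (rule smooth_on_cong[OF open_U, rotated])
      (use gram_nonzero in \<open>simp add: F field_simps power2_eq_square\<close>)
  show ?thesis
    by (rule smooth_on_vec[OF open_U]) (metis (mono_tags) exhaust_2 w1 w2)
qed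

lemma smooth_on_christoffel_form: "smooth_on U (\<lambda>q. christoffel_form h q y z)"
proof (rule smooth_on_solve)
  fix x
  have "smooth_on U (\<lambda>q. (1/2) * (ddir y (\<lambda>q. h q z x) q + ddir z (\<lambda>q. h q y x) q - ddir x (\<lambda>q. h q y z) q))"
    by (intro smooth_on_intros open_U smooth_G)
  then show "smooth_on U (\<lambda>u. h u (christoffel_form h u y z) x)"
  proof (rule smooth_on_cong[OF open_U, rotated])
    fix u assume "u \<in> U"
    then show "(1/2) * (ddir y (\<lambda>q. h q z x) u + ddir z (\<lambda>q. h q y x) u - ddir x (\<lambda>q. h q y z) u)
        = h u (christoffel_form h u y z) x"
      using koszul[of u y z x] by simp
  qed
qed

text \<open>The structure equation of a moving frame. If the connection is \<open>\<nabla>a = \<theta> b\<close>, \<open>\<nabla>b = \<epsilon>\<theta> a\<close>, then the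
  terms quadratic in \<open>\<theta>\<close> cancel and the curvature operator sends \<open>a\<close> to \<open>d\<theta> b\<close> and \<open>b\<close> to \<open>\<epsilon> d\<theta> a\<close>. The
  last factor is the determinant of the frame in the coordinate basis; it converts
  \<open>d\<theta>(e\<^sub>1, e\<^sub>2)\<close> into \<open>d\<theta>(a, b)\<close>.\<close>

lemma gauss_curvature_frame:
  fixes a b :: "real^2 \<Rightarrow> real^2" and \<theta> :: "real^2 \<Rightarrow> real^2 \<Rightarrow> real"
  assumes u: "u \<in> U" and a: "smooth_on U a" and b: "smooth_on U b"
    and \<theta>: "\<And>w. smooth_on U (\<lambda>v. \<theta> v w)"
    and na: "\<And>v w. v \<in> U \<Longrightarrow> cov_along h (\<lambda>q. q) v w a = \<theta> v w *\<^sub>R b v"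
    and nb: "\<And>v w. v \<in> U \<Longrightarrow> cov_along h (\<lambda>q. q) v w b = (\<epsilon> * \<theta> v w) *\<^sub>R a v"
    and orth: "h u (a u) (b u) = 0" and hbb: "h u (b u) (b u) = - \<epsilon> * h u (a u) (a u)"
    and nz: "h u (a u) (a u) \<noteq> 0" "\<epsilon> \<noteq> 0"
  shows "gauss_curvature h u * h u (a u) (a u) =
    - (ddir (axis 1 1) (\<lambda>v. \<theta> v (axis 2 1)) u - ddir (axis 2 1) (\<lambda>v. \<theta> v (axis 1 1)) u)
      * (a u $ 1 * b u $ 2 - a u $ 2 * b u $ 1)"
proof -
  define e1 e2 :: "real^2" where "e1 = axis 1 1" and "e2 = axis 2 1"
  define \<kappa> where "\<kappa> = ddir e1 (\<lambda>v. \<theta> v e2) u - ddir e2 (\<lambda>v. \<theta> v e1) u"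
  define R where "R z = riemann h (\<lambda>_. e1) (\<lambda>_. e2) (\<lambda>_. z) u" for z
  note d = smooth_on_differentiable[OF _ u]
  have linR: "linear R"
    unfolding R_def by (rule riemann_linear[OF open_U u smooth_on_christoffel_form])
  have tensor: "riemann h (\<lambda>_. e1) (\<lambda>_. e2) Z u = R (Z u)" if "smooth_on U Z" for Z
    by (simp add: R_def riemann_coordinate[OF open_U u smooth_on_christoffel_form that]
        riemann_coordinate[OF open_U u smooth_on_christoffel_form smooth_on_const])
  have second: "cov_along h (\<lambda>q. q) u x (\<lambda>q. cov_along h (\<lambda>q. q) q y Z)
      = ddir x (\<lambda>v. f v y) u *\<^sub>R Z' u + f u y *\<^sub>R cov_along h (\<lambda>q. q) u x Z'"
    if "\<And>v w. v \<in> U \<Longrightarrow> cov_along h (\<lambda>q. q) v w Z = f v w *\<^sub>R Z' v"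
      "smooth_on U (\<lambda>v. f v y)" "smooth_on U Z'" for x y Z Z' and f :: "real^2 \<Rightarrow> real^2 \<Rightarrow> real"
  proof -
    have "ddir x (\<lambda>q. cov_along h (\<lambda>q. q) q y Z) u = ddir x (\<lambda>v. f v y *\<^sub>R Z' v) u"
      by (rule fun_cong[OF frechet_derivative_cong_on[OF open_U u]]) (rule that(1))
    also have "\<dots> = f u y *\<^sub>R ddir x Z' u + ddir x (\<lambda>v. f v y) u *\<^sub>R Z' u"
      by (rule ddir_scaleR) (intro d that)+
    finally show ?thesis
      by (simp add: cov_along_id[of h u x "\<lambda>q. cov_along h (\<lambda>q. q) q y Z"] cov_along_id[of h u x Z']
          that(1)[OF u] christoffel_form_simps algebra_simps)
  qed
  have \<epsilon>\<theta>: "smooth_on U (\<lambda>v. \<epsilon> * \<theta> v w)" for w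
    by (intro smooth_on_intros open_U \<theta>)
  have d\<epsilon>: "ddir x (\<lambda>v. \<epsilon> * \<theta> v w) u = \<epsilon> * ddir x (\<lambda>v. \<theta> v w) u" for x w
    by (rule fun_cong[OF frechet_derivative_at[OF has_derivative_mult_right[OF has_derivative_frechet[OF d[OF \<theta>]]]], symmetric])
  have Ra: "R (a u) = \<kappa> *\<^sub>R b u"
    unfolding tensor[OF a, symmetric] riemann_const_fields[OF d[OF a]]
    by (simp add: second[OF na \<theta> b] nb[OF u] \<kappa>_def algebra_simps)
  have Rb: "R (b u) = (\<epsilon> * \<kappa>) *\<^sub>R a u"
    unfolding tensor[OF b, symmetric] riemann_const_fields[OF d[OF b]]
    by (simp add: second[OF nb \<epsilon>\<theta> a] na[OF u] \<kappa>_def d\<epsilon> algebra_simps)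
  define a1 a2 b1 b2 where "a1 = a u $ 1" and "a2 = a u $ 2" and "b1 = b u $ 1" and "b2 = b u $ 2"
  define \<Delta> where "\<Delta> = a1 * b2 - a2 * b1"
  have e2: "\<Delta> *\<^sub>R e2 = a1 *\<^sub>R b u - b1 *\<^sub>R a u" and e1: "\<Delta> *\<^sub>R e1 = b2 *\<^sub>R a u - a2 *\<^sub>R b u"
    by (auto simp: \<Delta>_def e1_def e2_def a1_def a2_def b1_def b2_def vec_eq_iff forall_2 axis_def)
  have Re2: "\<Delta> *\<^sub>R R e2 = \<kappa> *\<^sub>R ((a1 * \<epsilon>) *\<^sub>R a u - b1 *\<^sub>R b u)"
  proof -
    have "\<Delta> *\<^sub>R R e2 = R (\<Delta> *\<^sub>R e2)" by (simp add: linear_scale[OF linR])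
    also have "\<dots> = a1 *\<^sub>R R (b u) - b1 *\<^sub>R R (a u)"
      by (simp add: e2 linear_diff[OF linR] linear_scale[OF linR])
    finally show ?thesis by (simp add: Ra Rb algebra_simps)
  qed
  note bil = bilinear_G[OF u]
  note bs = bilinear_lmul[OF bil] bilinear_rmul[OF bil] bilinear_lsub[OF bil] bilinear_rsub[OF bil]
  have num: "\<Delta> * (\<Delta> * h u (R e2) e1) = \<epsilon> * \<kappa> * h u (a u) (a u) * \<Delta>"
  proof -
    have "\<Delta> * (\<Delta> * h u (R e2) e1) = h u (\<Delta> *\<^sub>R R e2) (\<Delta> *\<^sub>R e1)"
      by (simp add: bs)
    also have "\<dots> = \<epsilon> * \<kappa> * h u (a u) (a u) * \<Delta>"
      unfolding Re2 e1 using sym_G[OF u, of "b u" "a u"]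
      by (simp add: bs orth hbb \<Delta>_def algebra_simps)
    finally show ?thesis .
  qed
  have gram: "\<Delta>\<^sup>2 * (h u e1 e1 * h u e2 e2 - (h u e1 e2)\<^sup>2) = - \<epsilon> * (h u (a u) (a u))\<^sup>2"
  proof -
    have "\<Delta>\<^sup>2 * (h u e1 e1 * h u e2 e2 - (h u e1 e2)\<^sup>2)
        = h u (a u) (a u) * h u (b u) (b u) - (h u (a u) (b u))\<^sup>2"
      unfolding h_expand[OF u, of "a u"] h_expand[OF u, of "b u" "b u"]
      by (simp add: \<Delta>_def a1_def a2_def b1_def b2_def e1_def e2_def power2_eq_square algebra_simps)
    then show ?thesis by (simp add: orth hbb power2_eq_square)
  qed
  have "\<Delta> \<noteq> 0" using gram nz by auto
  have K: "gauss_curvature h u = h u (R e2) e1 / (h u e1 e1 * h u e2 e2 - (h u e1 e2)\<^sup>2)"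
    by (simp add: gauss_curvature_def Let_def R_def e1_def e2_def)
  have "gauss_curvature h u = (\<Delta> * (\<Delta> * h u (R e2) e1)) / (\<Delta>\<^sup>2 * (h u e1 e1 * h u e2 e2 - (h u e1 e2)\<^sup>2))"
    unfolding K using \<open>\<Delta> \<noteq> 0\<close> by (simp add: power2_eq_square)
  also have "\<dots> = - \<kappa> * \<Delta> / h u (a u) (a u)"
    unfolding num gram using nz by (simp add: power2_eq_square)
  finally show ?thesis
    using nz by (simp add: \<kappa>_def \<Delta>_def a1_def a2_def b1_def b2_def e1_def e2_def)
qed

end

section \<open>Immersed surfaces and the Gauss formula\<close>

locale immersion = pseudo_metric U G for U :: "(real^3) set" and G +
  fixes W :: "(real^2) set" and \<phi> :: "real^2 \<Rightarrow> real^3"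
  assumes open_W: "open W" and smooth_\<phi>: "smooth_on W \<phi>" and into: "\<phi> ` W \<subseteq> U"
    and nondegenerate_induced:
      "\<And>u v. u \<in> W \<Longrightarrow> (\<And>w. induced_metric G \<phi> u v w = 0) \<Longrightarrow> v = 0"
begin

abbreviation "h \<equiv> induced_metric G \<phi>"

lemma \<phi>_diff: "u \<in> W \<Longrightarrow> \<phi> differentiable (at u)"
  using smooth_\<phi> smooth_on_differentiable by blast

lemma \<phi>_in: "u \<in> W \<Longrightarrow> \<phi> u \<in> U"
  using into by auto

lemma smooth_on_metric_along:
  assumes "smooth_on W V" "smooth_on W X"
  shows "smooth_on W (\<lambda>u. G (\<phi> u) (V u) (X u))"
proof -
  have "smooth_on W (\<lambda>u. \<Sum>i\<in>UNIV. \<Sum>j\<in>UNIV. V u $ i * X u $ j * G (\<phi> u) (axis i 1) (axis j 1))"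
    by (intro smooth_on_intros open_W assms smooth_on_compose[OF open_W into smooth_G smooth_\<phi>])
  then show ?thesis
    by (rule smooth_on_cong[OF open_W, rotated]) (rule bilinear_expand[OF bilinear_G[OF \<phi>_in], symmetric])
qed

sublocale induced: surface_metric W h
proof
  fix q y z assume q: "q \<in> W"
  note bil = bilinear_G[OF \<phi>_in[OF q]] and lin = ddir_linear[OF \<phi>_diff[OF q]]
  show "bilinear (h q)"
    by (auto simp: bilinear_def induced_metric_def linear_add[OF lin] linear_scale[OF lin] bilinear_ladd[OF bil]
        bilinear_radd[OF bil] bilinear_lmul[OF bil] bilinear_rmul[OF bil] intro!: linearI)
  show "h q y z = h q z y"
    unfolding induced_metric_def by (rule sym_G[OF \<phi>_in[OF q]])
next
  show "smooth_on W (\<lambda>q. h q y z)" for y z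
    unfolding induced_metric_def by (intro smooth_on_metric_along smooth_on_ddir smooth_\<phi>)
qed (use open_W nondegenerate_induced in auto)

text \<open>The derivatives \<open>\<nabla>\<^sub>x \<phi>\<^sub>y\<close> of the coordinate fields are symmetric in \<open>x\<close> and \<open>y\<close>, so the Koszul
  formula of the induced metric collapses to their tangential part.\<close>

lemma gauss_formula:
  assumes u: "u \<in> W" and Y: "Y differentiable (at u)"
  shows "h u (cov_along h (\<lambda>v. v) u w Y) z =
    G (\<phi> u) (cov_along G \<phi> u w (\<lambda>v. ddir (Y v) \<phi> v)) (ddir z \<phi> u)"
proof -
  note p = \<phi>_in[OF u]
  note bil = bilinear_G[OF p]
  note dd = smooth_on_differentiable[OF smooth_on_ddir[OF smooth_\<phi>] u]
  define K where "K x y = cov_along G \<phi> u x (ddir y \<phi>)" for x y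
  have K_sym: "K x y = K y x" for x y
    using ddir_commute[OF open_W u smooth_\<phi>] christoffel_form_sym[OF p] by (simp add: K_def cov_along_def)
  have D: "ddir x (\<lambda>v. h v y z) u = G (\<phi> u) (K x y) (ddir z \<phi> u) + G (\<phi> u) (ddir y \<phi> u) (K x z)" for x y z
    unfolding induced_metric_def K_def
    by (rule ddir_metric_along[OF open_W u into \<phi>_diff[OF u] dd dd])
  have "2 * h u (christoffel_form h u x y) z = 2 * G (\<phi> u) (K x y) (ddir z \<phi> u)" for x y
    unfolding induced.koszul[OF u] D
    using K_sym[of y x] K_sym[of z x] K_sym[of z y] sym_G[OF p, of "ddir x \<phi> u"] sym_G[OF p, of "ddir y \<phi> u"]
    by simp
  then have \<Gamma>: "h u (christoffel_form h u x y) z = G (\<phi> u) (K x y) (ddir z \<phi> u)" for x y by simp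
  have lin: "linear (\<lambda>y. ddir y \<phi> q)" if "q \<in> W" for q
    by (rule ddir_linear[OF \<phi>_diff[OF that]])
  have "ddir w (\<lambda>v. ddir (Y v) \<phi> v) u = ddir w (ddir (Y u) \<phi>) u + ddir (ddir w Y u) \<phi> u"
    using ddir_linear_family[OF open_W u lin dd Y] by simp
  then have "cov_along G \<phi> u w (\<lambda>v. ddir (Y v) \<phi> v) = ddir (ddir w Y u) \<phi> u + K w (Y u)"
    by (simp add: cov_along_def K_def)
  then show ?thesis
    using \<Gamma>[of w "Y u"]
    by (simp add: cov_along_id bilinear_ladd[OF bil] bilinear_ladd[OF induced.bilinear_G[OF u]])
      (simp add: induced_metric_def)
qed

end

section \<open>The Lorentzian Heisenberg group\<close>

lemma heis_frame_eqI:
  assumes "x $ 1 = y $ 1" "x $ 2 = y $ 2" "contact_form \<tau> p x = contact_form \<tau> p y"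
  shows "x = y"
  using assms by (simp add: contact_form_def vec_eq_iff forall_3)

lemma contact_form_linear: "linear (contact_form \<tau> p)"
  by (auto simp: contact_form_def algebra_simps intro!: linearI)

lemma heis_pseudo_metric:
  assumes "\<delta> \<in> {1, -1}"
  shows "pseudo_metric UNIV (heis_metric \<tau> \<delta>)"
proof
  show "bilinear (heis_metric \<tau> \<delta> q)" for q
    by (auto simp: bilinear_def heis_metric_def contact_form_def algebra_simps intro!: linearI)
  show "heis_metric \<tau> \<delta> q y z = heis_metric \<tau> \<delta> q z y" for q y z
    by (simp add: heis_metric_def mult_ac)
  show "y = 0" if "\<And>z. heis_metric \<tau> \<delta> q y z = 0" for q y
  proof (rule heis_frame_eqI[where \<tau> = \<tau> and p = q])
    show "y $ 1 = 0 $ 1" "y $ 2 = 0 $ 2" "contact_form \<tau> q y = contact_form \<tau> q 0"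
      using that[of "E1 \<tau> q"] that[of "E2 \<tau> q"] that[of "E3 q"] assms
      by (auto simp: heis_defs)
  qed
  show "smooth_on UNIV (\<lambda>q. heis_metric \<tau> \<delta> q y z)" for y z
    unfolding heis_metric_def contact_form_def by (intro smooth_on_intros open_UNIV smooth_on_ident)
qed simp

lemma ddir_heis_metric:
  "ddir x (\<lambda>q. heis_metric \<tau> \<delta> q y z) p =
    \<delta> * \<tau> * ((x$2 * y$1 - x$1 * y$2) * contact_form \<tau> p z + contact_form \<tau> p y * (x$2 * z$1 - x$1 * z$2))"
proof -
  have "((\<lambda>q. heis_metric \<tau> \<delta> q y z) has_derivative (\<lambda>x.
    \<delta> * \<tau> * ((x$2 * y$1 - x$1 * y$2) * contact_form \<tau> p z + contact_form \<tau> p y * (x$2 * z$1 - x$1 * z$2)))) (at p)"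
    unfolding heis_metric_def contact_form_def
    by (rule derivative_eq_intros bounded_linear.has_derivative[OF bounded_linear_vec_nth] refl)+
      (simp add: fun_eq_iff algebra_simps)
  from fun_cong[OF frechet_derivative_at[OF this], of x] show ?thesis by simp
qed

text \<open>Left-invariance of the metric shows in the fact that, written in the frame, the connection has
  constant coefficients. The \<open>E\<^sub>3\<close> component vanishes, since \<open>\<nabla>\<^bsub>E\<^sub>1\<^esub> E\<^sub>2 = - \<nabla>\<^bsub>E\<^sub>2\<^esub> E\<^sub>1 = \<tau> E\<^sub>3\<close> is accounted for
  by the derivatives of \<open>E\<^sub>1\<close> and \<open>E\<^sub>2\<close>.\<close>

lemma heis_christoffel_form:
  assumes \<delta>: "\<delta> \<in> {1, -1}"
  shows "christoffel_form (heis_metric \<tau> \<delta>) p x y =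
     (\<tau> * \<delta> * (contact_form \<tau> p x * y$2 + x$2 * contact_form \<tau> p y)) *\<^sub>R E1 \<tau> p
     + (\<tau> * (contact_form \<tau> p x * y$1 + x$1 * contact_form \<tau> p y)) *\<^sub>R E2 \<tau> p"
proof -
  interpret pseudo_metric UNIV "heis_metric \<tau> \<delta>" by (rule heis_pseudo_metric[OF \<delta>])
  have dd: "\<delta> * \<delta> = 1" using \<delta> by auto
  show ?thesis
  proof (rule nondegenerate_eq[of p])
    fix z
    define X Y Z where "X = contact_form \<tau> p x" and "Y = contact_form \<tau> p y" and "Z = contact_form \<tau> p z"
    have c: "contact_form \<tau> p (E1 \<tau> p) = 0" "contact_form \<tau> p (E2 \<tau> p) = 0"
      by (simp_all add: heis_defs)
    have "2 * heis_metric \<tau> \<delta> p ((\<tau> * \<delta> * (X * y$2 + x$2 * Y)) *\<^sub>R E1 \<tau> p + (\<tau> * (X * y$1 + x$1 * Y)) *\<^sub>R E2 \<tau> p) z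
        = 2 * (\<tau> * \<delta> * (X * y$2 + x$2 * Y) * z$1 - \<delta> * (\<tau> * (X * y$1 + x$1 * Y) * z$2))"
      by (simp add: heis_metric_def linear_add[OF contact_form_linear] linear_scale[OF contact_form_linear] c)
        (simp add: E1_def E2_def)
    moreover have "2 * heis_metric \<tau> \<delta> p (christoffel_form (heis_metric \<tau> \<delta>) p x y) z
      = \<delta> * \<tau> * ((x$2 * y$1 - x$1 * y$2) * Z + Y * (x$2 * z$1 - x$1 * z$2))
      + \<delta> * \<tau> * ((y$2 * x$1 - y$1 * x$2) * Z + X * (y$2 * z$1 - y$1 * z$2))
      - \<delta> * \<tau> * ((z$2 * x$1 - z$1 * x$2) * Y + X * (z$2 * y$1 - z$1 * y$2))"
      by (simp add: koszul ddir_heis_metric X_def Y_def Z_def)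
    ultimately show "heis_metric \<tau> \<delta> p (christoffel_form (heis_metric \<tau> \<delta>) p x y) z
      = heis_metric \<tau> \<delta> p ((\<tau> * \<delta> * (contact_form \<tau> p x * y$2 + x$2 * contact_form \<tau> p y)) *\<^sub>R E1 \<tau> p
     + (\<tau> * (contact_form \<tau> p x * y$1 + x$1 * contact_form \<tau> p y)) *\<^sub>R E2 \<tau> p) z"
      unfolding X_def[symmetric] Y_def[symmetric] by (simp add: algebra_simps)
  qed simp
qed

text \<open>In frame components. The third component carries no connection term, because \<open>contact_form\<close> is
  applied to the coordinate derivative of \<open>V\<close> and not differentiated itself: the derivative of the
  form cancels the connection term \<open>\<tau>(x\<^sub>1 V\<^sub>2 - x\<^sub>2 V\<^sub>1) E\<^sub>3\<close>.\<close>

lemma heis_cov_along: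
  fixes \<phi> V :: "real^2 \<Rightarrow> real^3" and u :: "real^2"
  assumes "\<delta> \<in> {1, -1}"
  defines "x \<equiv> \<lambda>w. ddir w \<phi> u"
  shows "cov_along (heis_metric \<tau> \<delta>) \<phi> u w V $ 1 = ddir w V u $ 1
      + \<tau> * \<delta> * (contact_form \<tau> (\<phi> u) (x w) * V u $ 2 + x w $ 2 * contact_form \<tau> (\<phi> u) (V u))"
    and "cov_along (heis_metric \<tau> \<delta>) \<phi> u w V $ 2 = ddir w V u $ 2
      + \<tau> * (contact_form \<tau> (\<phi> u) (x w) * V u $ 1 + x w $ 1 * contact_form \<tau> (\<phi> u) (V u))"
    and "contact_form \<tau> (\<phi> u) (cov_along (heis_metric \<tau> \<delta>) \<phi> u w V) = contact_form \<tau> (\<phi> u) (ddir w V u)"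
  unfolding cov_along_def heis_christoffel_form[OF assms(1)] x_def
  by (simp_all add: linear_add[OF contact_form_linear] linear_scale[OF contact_form_linear])
    (simp_all add: E1_def E2_def contact_form_def)

section \<open>The adapted frame of a constant angle surface\<close>

text \<open>One parametrized piece of the surface: \<open>\<phi>\<close> is the parametrization and \<open>n\<close> the unit normal along
  it.\<close>

locale constant_angle_patch =
  fixes \<tau> \<delta> \<epsilon> \<nu> :: real and U :: "(real^2) set" and \<phi> n :: "real^2 \<Rightarrow> real^3"
  assumes \<delta>: "\<delta> \<in> {1, -1}" and \<epsilon>: "\<epsilon> \<in> {1, -1}"
    and U: "open U" and \<phi>: "smooth_on U \<phi>" and n: "smooth_on U n"
    and nondeg: "\<And>u v. u \<in> U \<Longrightarrow> (\<And>w. induced_metric (heis_metric \<tau> \<delta>) \<phi> u v w = 0) \<Longrightarrow> v = 0"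
    and unit: "\<And>u. u \<in> U \<Longrightarrow> heis_metric \<tau> \<delta> (\<phi> u) (n u) (n u) = \<epsilon>"
    and normal: "\<And>u v. u \<in> U \<Longrightarrow> heis_metric \<tau> \<delta> (\<phi> u) (n u) (ddir v \<phi> u) = 0"
    and angle: "\<And>u. u \<in> U \<Longrightarrow> \<epsilon> * heis_metric \<tau> \<delta> (\<phi> u) (n u) (E3 (\<phi> u)) = \<nu>"
begin

abbreviation "G \<equiv> heis_metric \<tau> \<delta>"

sublocale immersion UNIV G U \<phi>
proof -
  interpret pseudo_metric UNIV G by (rule heis_pseudo_metric[OF \<delta>])
  show "immersion UNIV G U \<phi>"
    by unfold_locales (use U \<phi> nondeg in auto)
qed

lemma signs: "\<delta> * \<delta> = 1" "\<epsilon> * \<epsilon> = 1"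
  using \<delta> \<epsilon> by auto

text \<open>The fields \<open>a\<close> and \<open>b\<close> are \<open>T\<close> and \<open>JT\<close> in coordinates. For \<open>c\<close>, \<open>\<omega>\<close>, \<open>\<eta>\<close> and
  \<open>\<theta>\<close> see the introduction; the second arguments of these forms are coordinate vectors.\<close>

definition "c = \<epsilon> - \<delta> * \<nu>\<^sup>2"

definition "T u = E3 (\<phi> u) - \<nu> *\<^sub>R n u"
definition "JT u = heis_cross \<tau> \<delta> (\<phi> u) (n u) (T u)"
definition "a u = tangent_coords \<phi> u (T u)"
definition "b u = tangent_coords \<phi> u (JT u)"
definition "\<eta> u w = contact_form \<tau> (\<phi> u) (ddir w \<phi> u)"
definition "\<omega> u w = (n u $ 1 * ddir w n u $ 2 - n u $ 2 * ddir w n u $ 1) / c"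
definition "\<mu> u = - \<delta> * \<omega> u (b u)"
definition "\<theta> u w = - \<nu> * \<delta> * (\<omega> u w + 2 * \<tau> * \<eta> u w)"

lemma contact_n:
  assumes "u \<in> U"
  shows "contact_form \<tau> (\<phi> u) (n u) = \<epsilon> * \<delta> * \<nu>"
proof -
  have "\<epsilon> * (\<delta> * contact_form \<tau> (\<phi> u) (n u)) = \<nu>"
    using angle[OF assms] by (simp add: heis_metric_def contact_form_def E3_def)
  moreover have "z = \<epsilon> * \<delta> * \<nu>" if "\<epsilon> * (\<delta> * z) = \<nu>" for z
    using signs that by algebra
  ultimately show ?thesis by blast
qed

lemma n_conic:
  assumes "u \<in> U"
  shows "(n u $ 1)\<^sup>2 - \<delta> * (n u $ 2)\<^sup>2 = c"
proof -
  have "n u $ 1 * n u $ 1 - \<delta> * (n u $ 2 * n u $ 2) + \<delta> * ((\<epsilon> * \<delta> * \<nu>) * (\<epsilon> * \<delta> * \<nu>)) = \<epsilon>"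
    using unit[OF assms] by (simp add: heis_metric_def contact_n[OF assms])
  moreover have "x\<^sup>2 - \<delta> * y\<^sup>2 = \<epsilon> - \<delta> * \<nu>\<^sup>2"
    if "x * x - \<delta> * (y * y) + \<delta> * ((\<epsilon> * \<delta> * \<nu>) * (\<epsilon> * \<delta> * \<nu>)) = \<epsilon>" for x y
    using signs that by algebra
  ultimately show ?thesis unfolding c_def by blast
qed

lemma T_components:
  assumes "u \<in> U"
  shows "T u $ 1 = - \<nu> * n u $ 1" "T u $ 2 = - \<nu> * n u $ 2"
    "contact_form \<tau> (\<phi> u) (T u) = 1 - \<epsilon> * \<delta> * \<nu>\<^sup>2"
proof -
  have "contact_form \<tau> (\<phi> u) (E3 (\<phi> u)) = 1" by (simp add: heis_defs)
  then show "contact_form \<tau> (\<phi> u) (T u) = 1 - \<epsilon> * \<delta> * \<nu>\<^sup>2"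
    by (simp add: T_def linear_diff[OF contact_form_linear] linear_scale[OF contact_form_linear]
        contact_n[OF assms] power2_eq_square)
qed (simp_all add: T_def E3_def)

lemma JT_components:
  assumes "u \<in> U"
  shows "JT u $ 1 = n u $ 2" "JT u $ 2 = \<delta> * n u $ 1" "contact_form \<tau> (\<phi> u) (JT u) = 0"
proof -
  have c: "contact_form \<tau> (\<phi> u) (E1 \<tau> (\<phi> u)) = 0" "contact_form \<tau> (\<phi> u) (E2 \<tau> (\<phi> u)) = 0"
    by (simp_all add: heis_defs)
  show "contact_form \<tau> (\<phi> u) (JT u) = 0"
    by (simp add: JT_def heis_cross_def linear_add[OF contact_form_linear] linear_scale[OF contact_form_linear] c
        T_components[OF assms])
  show "JT u $ 1 = n u $ 2" "JT u $ 2 = \<delta> * n u $ 1"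
    by (simp_all add: JT_def heis_cross_def T_components[OF assms] contact_n[OF assms])
      (simp_all add: E1_def E2_def E3_def power2_eq_square algebra_simps)
qed

lemma tangent_inj:
  assumes u: "u \<in> U" and "ddir v \<phi> u = ddir w \<phi> u"
  shows "v = w"
proof -
  have "ddir (v - w) \<phi> u = 0" using assms linear_diff[OF ddir_linear[OF \<phi>_diff[OF u]]] by simp
  then have "induced_metric G \<phi> u (v - w) z = 0" for z
    by (simp add: induced_metric_def bilinear_lzero[OF bilinear_G])
  then show ?thesis using nondeg[OF u, of "v - w"] by simp
qed

text \<open>The differential of \<open>\<phi>\<close> together with \<open>n\<close> is an injective, hence surjective, linear map from
  \<open>\<real>\<^sup>2 \<times> \<real>\<close> to \<open>\<real>\<^sup>3\<close>, so a vector orthogonal to \<open>n\<close> lies in the image of the differential.\<close>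

lemma tangent_coords:
  assumes u: "u \<in> U" and X: "G (\<phi> u) (n u) X = 0"
  shows "ddir (tangent_coords \<phi> u X) \<phi> u = X"
proof -
  define L where "L y = ddir (vector [y$1, y$2] :: real^2) \<phi> u + y$3 *\<^sub>R n u" for y :: "real^3"
  note lin = ddir_linear[OF \<phi>_diff[OF u]]
  have "linear L"
  proof (rule linearI)
    have v: "vector [x + x', y + y'] = (vector [x, y] + vector [x', y'] :: real^2)"
      "vector [r * x, r * y] = (r *\<^sub>R vector [x, y] :: real^2)" for x x' y y' r :: real
      by (simp_all add: vec_eq_iff forall_2)
    show "L (x + y) = L x + L y" for x y
      by (simp add: L_def v linear_add[OF lin] algebra_simps)
    show "L (r *\<^sub>R x) = r *\<^sub>R L x" for r x
      by (simp add: L_def v linear_scale[OF lin] algebra_simps)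
  qed
  have pair: "G (\<phi> u) (n u) (L y) = \<epsilon> * y$3" for y
    by (simp add: L_def bilinear_radd[OF bilinear_G] bilinear_rmul[OF bilinear_G] normal[OF u] unit[OF u])
  have "y = 0" if "L y = 0" for y
  proof -
    have y3: "y$3 = 0" using pair[of y] that \<epsilon> by (auto simp: bilinear_rzero[OF bilinear_G])
    then have "ddir (vector [y$1, y$2] :: real^2) \<phi> u = ddir 0 \<phi> u"
      using that linear_0[OF lin] by (simp add: L_def)
    then have "vector [y$1, y$2] = (0::real^2)" by (rule tangent_inj[OF u])
    then show ?thesis using y3 by (simp add: vec_eq_iff forall_2 forall_3)
  qed
  then have "surj L"
    using \<open>linear L\<close> by (intro linear_injective_imp_surjective) (simp_all add: linear_injective_0)
  then obtain y where y: "X = L y" by (metis surjD)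
  then have "y$3 = 0" using pair[of y] X \<epsilon> by auto
  then have ex: "ddir (vector [y$1, y$2] :: real^2) \<phi> u = X" by (simp add: y L_def)
  show ?thesis
    unfolding tangent_coords_def
    by (rule theI[of _ "vector [y$1, y$2]"]) (use ex tangent_inj[OF u] in auto)
qed

lemma tangent_T:
  assumes "u \<in> U"
  shows "G (\<phi> u) (n u) (T u) = 0"
proof -
  have "x * (- \<nu> * x) - \<delta> * (y * (- \<nu> * y)) + \<delta> * (\<epsilon> * \<delta> * \<nu> * (1 - \<epsilon> * \<delta> * \<nu>\<^sup>2)) = 0"
    if "x\<^sup>2 - \<delta> * y\<^sup>2 = \<epsilon> - \<delta> * \<nu>\<^sup>2" for x y
    using signs that by algebra
  then show ?thesis
    unfolding heis_metric_def T_components[OF assms] contact_n[OF assms]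
    using n_conic[OF assms] unfolding c_def by blast
qed

lemma tangent_JT: "u \<in> U \<Longrightarrow> G (\<phi> u) (n u) (JT u) = 0"
  using signs by (simp add: heis_metric_def JT_components)

lemma push_a: "u \<in> U \<Longrightarrow> ddir (a u) \<phi> u = T u"
  unfolding a_def by (intro tangent_coords tangent_T)

lemma push_b: "u \<in> U \<Longrightarrow> ddir (b u) \<phi> u = JT u"
  unfolding b_def by (intro tangent_coords tangent_JT)

lemma gram_frame:
  assumes "u \<in> U"
  shows "h u (a u) (a u) = \<epsilon> * \<delta> * c" "h u (a u) (b u) = 0" "h u (b u) (b u) = - \<delta> * c"
proof -
  have "(- \<nu> * x) * (- \<nu> * x) - \<delta> * ((- \<nu> * y) * (- \<nu> * y)) + \<delta> * ((1 - \<epsilon> * \<delta> * \<nu>\<^sup>2) * (1 - \<epsilon> * \<delta> * \<nu>\<^sup>2))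
      = \<epsilon> * \<delta> * (\<epsilon> - \<delta> * \<nu>\<^sup>2)"
    "(- \<nu> * x) * y - \<delta> * ((- \<nu> * y) * (\<delta> * x)) + \<delta> * ((1 - \<epsilon> * \<delta> * \<nu>\<^sup>2) * 0) = 0"
    "y * y - \<delta> * ((\<delta> * x) * (\<delta> * x)) + \<delta> * (0 * 0) = - \<delta> * (\<epsilon> - \<delta> * \<nu>\<^sup>2)"
    if "x\<^sup>2 - \<delta> * y\<^sup>2 = \<epsilon> - \<delta> * \<nu>\<^sup>2" for x y
    using signs that by algebra+
  from this[OF n_conic[OF assms, unfolded c_def]] show "h u (a u) (a u) = \<epsilon> * \<delta> * c" "h u (a u) (b u) = 0"
    "h u (b u) (b u) = - \<delta> * c"
    unfolding induced_metric_def push_a[OF assms] push_b[OF assms] heis_metric_def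
      T_components[OF assms] JT_components[OF assms] c_def by blast+
qed

text \<open>If \<open>c = 0\<close> then \<open>T\<close> is a null vector of the plane spanned by \<open>E\<^sub>1\<close> and \<open>E\<^sub>2\<close>, and so is \<open>JT\<close>;
  explicitly, \<open>N\<^sub>2 T + \<nu> N\<^sub>1 JT = 0\<close>.\<close>

lemma c_nonzero_if_independent:
  assumes u: "u \<in> U" and "T u \<noteq> JT u" "independent {T u, JT u}"
  shows "c \<noteq> 0"
proof
  assume c0: "c = 0"
  have indep: "r = 0 \<and> s = 0" if "r *\<^sub>R T u + s *\<^sub>R JT u = 0" for r s
    using assms(2,3) that dependent_finite[of "{T u, JT u}"]
    by (auto dest!: spec[of _ "\<lambda>v. if v = T u then r else s"])
  have "n u $ 2 = 0 \<and> \<nu> * n u $ 1 = 0"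
  proof (rule indep, rule heis_frame_eqI[where \<tau> = \<tau> and p = "\<phi> u"])
    have "\<epsilon> * (\<epsilon> - \<delta> * \<nu>\<^sup>2) = 0" using c0 by (simp add: c_def)
    then have "1 - \<epsilon> * \<delta> * \<nu>\<^sup>2 = 0" using signs by (simp add: algebra_simps)
    then show "contact_form \<tau> (\<phi> u) (n u $ 2 *\<^sub>R T u + (\<nu> * n u $ 1) *\<^sub>R JT u) = contact_form \<tau> (\<phi> u) 0"
      by (simp add: linear_add[OF contact_form_linear] linear_scale[OF contact_form_linear]
        linear_0[OF contact_form_linear] T_components[OF u] JT_components[OF u])
    have "y * (- \<nu> * y) + \<nu> * x * (\<delta> * x) = 0" if "x\<^sup>2 - \<delta> * y\<^sup>2 = 0" for x y
      using signs that by algebra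
    then show "(n u $ 2 *\<^sub>R T u + (\<nu> * n u $ 1) *\<^sub>R JT u) $ 2 = 0 $ 2"
      using n_conic[OF u] c0 by (simp add: T_components[OF u] JT_components[OF u])
  qed (simp add: T_components[OF u] JT_components[OF u])
  then have "n u $ 2 = 0" "n u $ 1 = 0" using n_conic[OF u] c0 by auto
  then have "JT u = 0"
    by (intro heis_frame_eqI[where \<tau> = \<tau> and p = "\<phi> u"])
      (simp_all add: JT_components[OF u] linear_0[OF contact_form_linear])
  then show False using indep[of 0 1] by simp
qed

end

locale helix_patch = constant_angle_patch +
  assumes T_not_null: "\<epsilon> - \<delta> * \<nu>\<^sup>2 \<noteq> 0"
begin

lemma c_nonzero: "c \<noteq> 0"
  using T_not_null by (simp add: c_def)

lemma frame_eqI: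
  assumes u: "u \<in> U" and "h u v (a u) = h u w (a u)" "h u v (b u) = h u w (b u)"
  shows "v = w"
proof -
  define X where "X = ddir (v - w) \<phi> u"
  have "h u (v - w) (a u) = 0" "h u (v - w) (b u) = 0"
    using assms by (simp_all add: bilinear_lsub[OF induced.bilinear_G[OF u]])
  then have "G (\<phi> u) X (T u) = 0" "G (\<phi> u) X (JT u) = 0" "G (\<phi> u) X (n u) = 0"
    using normal[OF u, of "v - w"] sym_G[of "\<phi> u" X "n u"]
    by (simp_all add: X_def induced_metric_def push_a[OF u] push_b[OF u])
  note z = this[unfolded heis_metric_def T_components[OF u] JT_components[OF u] contact_n[OF u]]
  have "x3 = 0" "(\<epsilon> - \<delta> * \<nu>\<^sup>2) * x1 = 0" "(\<epsilon> - \<delta> * \<nu>\<^sup>2) * x2 = 0"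
    if "x1 * (- \<nu> * x) - \<delta> * (x2 * (- \<nu> * y)) + \<delta> * (x3 * (1 - \<epsilon> * \<delta> * \<nu>\<^sup>2)) = 0"
      "x1 * y - \<delta> * (x2 * (\<delta> * x)) + \<delta> * (x3 * 0) = 0"
      "x1 * x - \<delta> * (x2 * y) + \<delta> * (x3 * (\<epsilon> * \<delta> * \<nu>)) = 0"
      "x\<^sup>2 - \<delta> * y\<^sup>2 = \<epsilon> - \<delta> * \<nu>\<^sup>2" for x y x1 x2 x3
  proof -
    show 3: "x3 = 0" using signs that(1,3) by algebra
    show "(\<epsilon> - \<delta> * \<nu>\<^sup>2) * x1 = 0" "(\<epsilon> - \<delta> * \<nu>\<^sup>2) * x2 = 0"
      using signs 3 that(2-4) by algebra+
  qed
  from this[OF z n_conic[OF u, unfolded c_def]]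
  have X3: "contact_form \<tau> (\<phi> u) X = 0" and "c * X$1 = 0" "c * X$2 = 0"
    unfolding c_def by blast+
  then have "X$1 = 0" "X$2 = 0" using c_nonzero by auto
  then have "X = 0"
    using X3 by (intro heis_frame_eqI[where \<tau> = \<tau> and p = "\<phi> u"]) (simp_all add: linear_0[OF contact_form_linear])
  then have "ddir (v - w) \<phi> u = ddir 0 \<phi> u"
    using linear_0[OF ddir_linear[OF \<phi>_diff[OF u]]] by (simp add: X_def)
  from tangent_inj[OF u this] show ?thesis by simp
qed

lemma smooth_T: "smooth_on U T"
  unfolding T_def E3_def by (intro smooth_on_intros U n)

lemma smooth_JT: "smooth_on U JT"
proof (rule smooth_on_vec[OF U])
  fix i :: 3
  have "smooth_on U (\<lambda>u. n u $ 2)" "smooth_on U (\<lambda>u. \<delta> * n u $ 1)"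
    "smooth_on U (\<lambda>u. - \<tau> * (\<phi> u $ 2 * n u $ 2 - \<phi> u $ 1 * (\<delta> * n u $ 1)))"
    by (intro smooth_on_intros U n \<phi>)+
  moreover have "JT u $ 3 = - \<tau> * (\<phi> u $ 2 * n u $ 2 - \<phi> u $ 1 * (\<delta> * n u $ 1))" if "u \<in> U" for u
    using JT_components[OF that] by (simp add: contact_form_def algebra_simps)
  ultimately have "smooth_on U (\<lambda>u. JT u $ 1)" "smooth_on U (\<lambda>u. JT u $ 2)" "smooth_on U (\<lambda>u. JT u $ 3)"
    using JT_components by (auto intro: smooth_on_cong[OF U])
  then show "smooth_on U (\<lambda>u. JT u $ i)" using exhaust_3[of i] by auto
qed

lemma smooth_a: "smooth_on U a"
proof (rule induced.smooth_on_solve)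
  fix z
  have "smooth_on U (\<lambda>u. G (\<phi> u) (T u) (ddir z \<phi> u))"
    by (intro smooth_on_metric_along smooth_T smooth_on_ddir \<phi>)
  then show "smooth_on U (\<lambda>u. h u (a u) z)"
    by (rule smooth_on_cong[OF U, rotated]) (simp add: induced_metric_def push_a)
qed

lemma smooth_b: "smooth_on U b"
proof (rule induced.smooth_on_solve)
  fix z
  have "smooth_on U (\<lambda>u. G (\<phi> u) (JT u) (ddir z \<phi> u))"
    by (intro smooth_on_metric_along smooth_JT smooth_on_ddir \<phi>)
  then show "smooth_on U (\<lambda>u. h u (b u) z)"
    by (rule smooth_on_cong[OF U, rotated]) (simp add: induced_metric_def push_b)
qed

end

section \<open>The angle form and the shape operator\<close>

context helix_patch
begin

lemma n_diff: "u \<in> U \<Longrightarrow> n differentiable (at u)"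
  using n smooth_on_differentiable by blast

lemma nth_derivative:
  fixes f :: "real^2 \<Rightarrow> real^3"
  assumes "smooth_on U f" "u \<in> U"
  shows "((\<lambda>u. f u $ i) has_derivative (\<lambda>v. ddir v f u $ i)) (at u)"
  by (intro bounded_linear.has_derivative[OF bounded_linear_vec_nth] has_derivative_frechet
      smooth_on_differentiable[OF assms])

text \<open>The derivative of the equation of the conic.\<close>

lemma dn_conic:
  assumes u: "u \<in> U"
  shows "n u $ 1 * ddir w n u $ 1 = \<delta> * n u $ 2 * ddir w n u $ 2"
proof -
  have d: "((\<lambda>u. n u $ 1 * n u $ 1 - \<delta> * (n u $ 2 * n u $ 2)) has_derivative
    (\<lambda>w. (n u $ 1 * ddir w n u $ 1 + ddir w n u $ 1 * n u $ 1)
       - \<delta> * (n u $ 2 * ddir w n u $ 2 + ddir w n u $ 2 * n u $ 2))) (at u)"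
    by (intro has_derivative_diff has_derivative_mult has_derivative_mult_right nth_derivative n u)
  have k: "n u $ 1 * n u $ 1 - \<delta> * (n u $ 2 * n u $ 2) = c" if "u \<in> U" for u
    using n_conic[OF that] by (simp add: power2_eq_square)
  have "(n u $ 1 * ddir w n u $ 1 + ddir w n u $ 1 * n u $ 1)
       - \<delta> * (n u $ 2 * ddir w n u $ 2 + ddir w n u $ 2 * n u $ 2) = 0"
    by (rule has_derivative_const_on[OF d U u k])
  then show ?thesis by (simp add: algebra_simps)
qed

lemma dn_components:
  assumes u: "u \<in> U"
  shows "ddir w n u $ 1 = \<delta> * n u $ 2 * \<omega> u w" "ddir w n u $ 2 = n u $ 1 * \<omega> u w"
    "contact_form \<tau> (\<phi> u) (ddir w n u) = \<tau> * (ddir w \<phi> u $ 1 * n u $ 2 - ddir w \<phi> u $ 2 * n u $ 1)"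
proof -
  have \<omega>: "c * \<omega> u w = n u $ 1 * ddir w n u $ 2 - n u $ 2 * ddir w n u $ 1"
    using c_nonzero by (simp add: \<omega>_def)
  have alg: "k * (\<delta> * y * s) = k * dx" "k * (x * s) = k * dy"
    if "k * s = x * dy - y * dx" "x * dx = \<delta> * y * dy" "x\<^sup>2 - \<delta> * y\<^sup>2 = k" for k s x y dx dy :: real
    using that by algebra+
  from alg[OF \<omega> dn_conic[OF u] n_conic[OF u]] c_nonzero
  show "ddir w n u $ 1 = \<delta> * n u $ 2 * \<omega> u w" "ddir w n u $ 2 = n u $ 1 * \<omega> u w"
    by auto
  have d: "((\<lambda>u. n u $ 3 + \<tau> * (\<phi> u $ 2 * n u $ 1 - \<phi> u $ 1 * n u $ 2)) has_derivative
    (\<lambda>w. ddir w n u $ 3 + \<tau> * ((\<phi> u $ 2 * ddir w n u $ 1 + ddir w \<phi> u $ 2 * n u $ 1)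
       - (\<phi> u $ 1 * ddir w n u $ 2 + ddir w \<phi> u $ 1 * n u $ 2)))) (at u)"
    by (intro has_derivative_add has_derivative_diff has_derivative_mult has_derivative_mult_right
        nth_derivative n \<phi> u)
  have k: "n u $ 3 + \<tau> * (\<phi> u $ 2 * n u $ 1 - \<phi> u $ 1 * n u $ 2) = \<epsilon> * \<delta> * \<nu>" if "u \<in> U" for u
    using contact_n[OF that] by (simp add: contact_form_def)
  have "ddir w n u $ 3 + \<tau> * ((\<phi> u $ 2 * ddir w n u $ 1 + ddir w \<phi> u $ 2 * n u $ 1)
       - (\<phi> u $ 1 * ddir w n u $ 2 + ddir w \<phi> u $ 1 * n u $ 2)) = 0"
    by (rule has_derivative_const_on[OF d U u k])
  then show "contact_form \<tau> (\<phi> u) (ddir w n u) = \<tau> * (ddir w \<phi> u $ 1 * n u $ 2 - ddir w \<phi> u $ 2 * n u $ 1)"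
    by (simp add: contact_form_def algebra_simps)
qed

lemma smooth_\<omega>: "smooth_on U (\<lambda>u. \<omega> u w)"
  unfolding \<omega>_def using c_nonzero by (intro smooth_on_intros U n) auto

lemma smooth_\<eta>: "smooth_on U (\<lambda>u. \<eta> u w)"
  unfolding \<eta>_def contact_form_def by (intro smooth_on_intros U \<phi>)

lemma linear_\<omega>: "u \<in> U \<Longrightarrow> linear (\<omega> u)"
  unfolding \<omega>_def
  by (rule linearI)
    (simp_all add: linear_add[OF ddir_linear[OF n_diff]] linear_scale[OF ddir_linear[OF n_diff]]
      algebra_simps add_divide_distrib diff_divide_distrib)

text \<open>Up to a factor, \<open>d\<omega>(v,w)\<close> is \<open>dN\<^sub>1(v) dN\<^sub>2(w) - dN\<^sub>2(v) dN\<^sub>1(w)\<close>, and both \<open>dN\<^sub>1\<close> and \<open>dN\<^sub>2\<close> are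
  multiples of \<open>\<omega>\<close>.\<close>

lemma \<omega>_closed:
  assumes u: "u \<in> U"
  shows "ddir v (\<lambda>u. \<omega> u w) u = ddir w (\<lambda>u. \<omega> u v) u"
proof -
  have d: "ddir v (\<lambda>u. \<omega> u w) u = ((n u $ 1 * ddir v (ddir w n) u $ 2 + ddir v n u $ 1 * ddir w n u $ 2)
       - (n u $ 2 * ddir v (ddir w n) u $ 1 + ddir v n u $ 2 * ddir w n u $ 1)) / c" for v w
  proof -
    have "((\<lambda>u. \<omega> u w) has_derivative (\<lambda>v. ((n u $ 1 * ddir v (ddir w n) u $ 2 + ddir v n u $ 1 * ddir w n u $ 2)
       - (n u $ 2 * ddir v (ddir w n) u $ 1 + ddir v n u $ 2 * ddir w n u $ 1)) / c)) (at u)"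
      unfolding \<omega>_def divide_inverse
      by (intro has_derivative_mult_left has_derivative_diff has_derivative_mult nth_derivative
          smooth_on_ddir n u)
    from fun_cong[OF frechet_derivative_at[OF this], of v] show ?thesis by simp
  qed
  show ?thesis
    unfolding d dn_components[OF u] ddir_commute[OF U u n, of v w] by (simp add: algebra_simps)
qed

lemma d\<eta>:
  assumes u: "u \<in> U"
  shows "ddir v (\<lambda>u. \<eta> u w) u - ddir w (\<lambda>u. \<eta> u v) u
    = 2 * \<tau> * (ddir v \<phi> u $ 2 * ddir w \<phi> u $ 1 - ddir v \<phi> u $ 1 * ddir w \<phi> u $ 2)"
proof -
  have d: "ddir v (\<lambda>u. \<eta> u w) u = ddir v (ddir w \<phi>) u $ 3
      + \<tau> * ((\<phi> u $ 2 * ddir v (ddir w \<phi>) u $ 1 + ddir v \<phi> u $ 2 * ddir w \<phi> u $ 1)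
        - (\<phi> u $ 1 * ddir v (ddir w \<phi>) u $ 2 + ddir v \<phi> u $ 1 * ddir w \<phi> u $ 2))" for v w
  proof -
    have "((\<lambda>u. \<eta> u w) has_derivative (\<lambda>v. ddir v (ddir w \<phi>) u $ 3
      + \<tau> * ((\<phi> u $ 2 * ddir v (ddir w \<phi>) u $ 1 + ddir v \<phi> u $ 2 * ddir w \<phi> u $ 1)
        - (\<phi> u $ 1 * ddir v (ddir w \<phi>) u $ 2 + ddir v \<phi> u $ 1 * ddir w \<phi> u $ 2)))) (at u)"
      unfolding \<eta>_def contact_form_def
      by (intro has_derivative_add has_derivative_mult_right has_derivative_diff has_derivative_mult
          nth_derivative smooth_on_ddir \<phi> u)
    from fun_cong[OF frechet_derivative_at[OF this], of v] show ?thesis by simp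
  qed
  show ?thesis
    unfolding d ddir_commute[OF U u \<phi>, of v w] by (simp add: algebra_simps)
qed

lemma normal_components:
  assumes "u \<in> U"
  shows "n u $ 1 * ddir w \<phi> u $ 1 - \<delta> * (n u $ 2 * ddir w \<phi> u $ 2) + \<epsilon> * \<nu> * \<eta> u w = 0"
proof -
  have *: "\<delta> * (\<epsilon> * \<delta> * \<nu> * y) = \<epsilon> * \<nu> * y" for y
    using \<delta> by auto
  then show ?thesis
    using normal[OF assms, of w] unfolding heis_metric_def contact_n[OF assms] * by (simp add: \<eta>_def)
qed

text \<open>This is \<open>g(\<nabla>\<^sub>v N, w) = g(\<nabla>\<^sub>w N, v)\<close>, obtained by differentiating the orthogonality relation in
  direction \<open>v\<close> and antisymmetrizing; the last term is \<open>d\<eta>\<close>.\<close>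

lemma shape_operator_symmetric:
  assumes u: "u \<in> U"
  shows "\<delta> * \<omega> u v * (n u $ 2 * ddir w \<phi> u $ 1 - n u $ 1 * ddir w \<phi> u $ 2)
    - \<delta> * \<omega> u w * (n u $ 2 * ddir v \<phi> u $ 1 - n u $ 1 * ddir v \<phi> u $ 2)
    + \<epsilon> * \<nu> * (2 * \<tau> * (ddir v \<phi> u $ 2 * ddir w \<phi> u $ 1 - ddir v \<phi> u $ 1 * ddir w \<phi> u $ 2)) = 0"
proof -
  have d: "(n u $ 1 * ddir v (ddir w \<phi>) u $ 1 + ddir v n u $ 1 * ddir w \<phi> u $ 1)
      - \<delta> * (n u $ 2 * ddir v (ddir w \<phi>) u $ 2 + ddir v n u $ 2 * ddir w \<phi> u $ 2)
      + \<epsilon> * \<nu> * ddir v (\<lambda>u. \<eta> u w) u = 0" for v w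
  proof -
    have "((\<lambda>u. n u $ 1 * ddir w \<phi> u $ 1 - \<delta> * (n u $ 2 * ddir w \<phi> u $ 2) + \<epsilon> * \<nu> * \<eta> u w) has_derivative
      (\<lambda>v. (n u $ 1 * ddir v (ddir w \<phi>) u $ 1 + ddir v n u $ 1 * ddir w \<phi> u $ 1)
      - \<delta> * (n u $ 2 * ddir v (ddir w \<phi>) u $ 2 + ddir v n u $ 2 * ddir w \<phi> u $ 2)
      + \<epsilon> * \<nu> * ddir v (\<lambda>u. \<eta> u w) u)) (at u)"
      by (intro has_derivative_add has_derivative_mult_right has_derivative_diff has_derivative_mult
          nth_derivative smooth_on_ddir \<phi> n u has_derivative_frechet
          smooth_on_differentiable[OF smooth_\<eta> u])
    from has_derivative_const_on[OF this U u normal_components] show ?thesis .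
  qed
  have "(ddir v n u $ 1 * ddir w \<phi> u $ 1 - ddir w n u $ 1 * ddir v \<phi> u $ 1)
      - \<delta> * (ddir v n u $ 2 * ddir w \<phi> u $ 2 - ddir w n u $ 2 * ddir v \<phi> u $ 2)
      + \<epsilon> * \<nu> * (ddir v (\<lambda>u. \<eta> u w) u - ddir w (\<lambda>u. \<eta> u v) u) = 0"
    using d[of v w] d[of w v] ddir_commute[OF U u \<phi>, of v w] by (simp add: algebra_simps)
  then show ?thesis
    unfolding d\<eta>[OF u] dn_components[OF u] by (simp add: algebra_simps)
qed

lemma \<eta>_frame:
  assumes "u \<in> U"
  shows "\<eta> u (a u) = 1 - \<epsilon> * \<delta> * \<nu>\<^sup>2" "\<eta> u (b u) = 0"
  using assms by (simp_all add: \<eta>_def push_a push_b T_components JT_components)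

text \<open>On the pair \<open>(JT, T)\<close> the coefficient of \<open>\<omega>(JT)\<close> in the symmetry of the shape operator vanishes,
  because the horizontal part of \<open>T\<close> is a multiple of that of \<open>N\<close>. So \<open>\<omega>(T)\<close> is determined.\<close>

lemma \<omega>_a:
  assumes u: "u \<in> U"
  shows "\<omega> u (a u) = 2 * \<tau> * \<epsilon> * \<delta> * \<nu>\<^sup>2"
proof -
  \<comment> \<open>\<open>x, y\<close> stand for \<open>N\<^sub>1, N\<^sub>2\<close>, and \<open>p\<close>, \<open>s\<close> for the values of \<open>\<omega>\<close> on \<open>JT\<close> and \<open>T\<close>; the factor of \<open>p\<close> is zero\<close>
  have "k * s = k * (2 * \<tau> * \<epsilon> * \<delta> * \<nu>\<^sup>2)"
    if "\<delta> * p * (y * (- \<nu> * x) - x * (- \<nu> * y)) - \<delta> * s * (y * y - x * (\<delta> * x))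
        + \<epsilon> * \<nu> * (2 * \<tau> * ((\<delta> * x) * (- \<nu> * x) - y * (- \<nu> * y))) = 0"
      "x\<^sup>2 - \<delta> * y\<^sup>2 = k" for k s p x y
    using signs that by algebra
  from this[OF shape_operator_symmetric[OF u, of "b u" "a u", unfolded push_a[OF u] push_b[OF u]
        T_components[OF u] JT_components[OF u]] n_conic[OF u]]
  show ?thesis using c_nonzero by simp
qed

lemma \<omega>_b: "\<omega> u (b u) = - \<delta> * \<mu> u"
  using signs by (simp add: \<mu>_def mult.assoc[symmetric])

lemma cov_n_a:
  assumes u: "u \<in> U"
  shows "cov_along G \<phi> u (a u) n = (\<delta> * \<tau>) *\<^sub>R JT u"
proof (rule heis_frame_eqI[where \<tau> = \<tau> and p = "\<phi> u"])
  have alg: "\<delta> * y * (2 * \<tau> * \<epsilon> * \<delta> * \<nu>\<^sup>2) + \<tau> * \<delta> * ((1 - \<epsilon> * \<delta> * \<nu>\<^sup>2) * y + (- \<nu> * y) * (\<epsilon> * \<delta> * \<nu>)) = \<delta> * \<tau> * y"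
    "x * (2 * \<tau> * \<epsilon> * \<delta> * \<nu>\<^sup>2) + \<tau> * ((1 - \<epsilon> * \<delta> * \<nu>\<^sup>2) * x + (- \<nu> * x) * (\<epsilon> * \<delta> * \<nu>)) = \<delta> * \<tau> * (\<delta> * x)"
    for x y using \<delta> by (auto simp: algebra_simps power2_eq_square)
  show "cov_along G \<phi> u (a u) n $ 1 = ((\<delta> * \<tau>) *\<^sub>R JT u) $ 1"
    using alg(1)[of "n u $ 2"]
    by (simp add: heis_cov_along[OF \<delta>] dn_components[OF u] push_a[OF u] T_components[OF u] JT_components[OF u]
        contact_n[OF u] \<omega>_a[OF u])
  show "cov_along G \<phi> u (a u) n $ 2 = ((\<delta> * \<tau>) *\<^sub>R JT u) $ 2"
    using alg(2)[of "n u $ 1"]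
    by (simp add: heis_cov_along[OF \<delta>] dn_components[OF u] push_a[OF u] T_components[OF u] JT_components[OF u]
        contact_n[OF u] \<omega>_a[OF u])
  show "contact_form \<tau> (\<phi> u) (cov_along G \<phi> u (a u) n) = contact_form \<tau> (\<phi> u) ((\<delta> * \<tau>) *\<^sub>R JT u)"
    by (simp add: heis_cov_along[OF \<delta>] dn_components[OF u] push_a[OF u] T_components[OF u] JT_components[OF u]
        linear_scale[OF contact_form_linear])
qed

lemma cov_n_b:
  assumes u: "u \<in> U"
  shows "cov_along G \<phi> u (b u) n = - ((\<delta> * \<epsilon> * \<tau>) *\<^sub>R T u + \<mu> u *\<^sub>R JT u)"
proof (rule heis_frame_eqI[where \<tau> = \<tau> and p = "\<phi> u"])
  have alg: "\<delta> * y * (- \<delta> * m) + \<tau> * \<delta> * (0 * y + (\<delta> * x) * (\<epsilon> * \<delta> * \<nu>))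
      = - (\<delta> * \<epsilon> * \<tau> * (- \<nu> * x) + m * y)"
    "x * (- \<delta> * m) + \<tau> * (0 * x + y * (\<epsilon> * \<delta> * \<nu>)) = - (\<delta> * \<epsilon> * \<tau> * (- \<nu> * y) + m * (\<delta> * x))"
    for x y m using \<delta> \<epsilon> by (auto simp: algebra_simps)
  have alg3: "\<tau> * (y * y - \<delta> * x * x) = - (\<delta> * \<epsilon> * \<tau> * (1 - \<epsilon> * \<delta> * \<nu>\<^sup>2))"
    if "x\<^sup>2 - \<delta> * y\<^sup>2 = \<epsilon> - \<delta> * \<nu>\<^sup>2" for x y
    using signs that by algebra
  show "cov_along G \<phi> u (b u) n $ 1 = (- ((\<delta> * \<epsilon> * \<tau>) *\<^sub>R T u + \<mu> u *\<^sub>R JT u)) $ 1"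
    using alg(1)[of "n u $ 2" "\<mu> u" "n u $ 1"]
    by (simp add: heis_cov_along[OF \<delta>] dn_components[OF u] push_b[OF u] T_components[OF u] JT_components[OF u]
        contact_n[OF u] \<omega>_b)
  show "cov_along G \<phi> u (b u) n $ 2 = (- ((\<delta> * \<epsilon> * \<tau>) *\<^sub>R T u + \<mu> u *\<^sub>R JT u)) $ 2"
    using alg(2)[of "n u $ 1" "\<mu> u" "n u $ 2"]
    by (simp add: heis_cov_along[OF \<delta>] dn_components[OF u] push_b[OF u] T_components[OF u] JT_components[OF u]
        contact_n[OF u] \<omega>_b)
  show "contact_form \<tau> (\<phi> u) (cov_along G \<phi> u (b u) n)
      = contact_form \<tau> (\<phi> u) (- ((\<delta> * \<epsilon> * \<tau>) *\<^sub>R T u + \<mu> u *\<^sub>R JT u))"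
    using alg3[OF n_conic[OF u, unfolded c_def]]
    by (simp add: heis_cov_along[OF \<delta>] dn_components[OF u] push_b[OF u] T_components[OF u] JT_components[OF u]
        linear_scale[OF contact_form_linear] linear_add[OF contact_form_linear] linear_neg[OF contact_form_linear]
        linear_diff[OF contact_form_linear])
qed

section \<open>Connection and curvature of the surface\<close>

lemma cov_push:
  assumes u: "u \<in> U" and "smooth_on U Y" and eq: "\<And>v. v \<in> U \<Longrightarrow> ddir (Y v) \<phi> v = V v"
  shows "h u (cov_along h (\<lambda>q. q) u w Y) z = G (\<phi> u) (cov_along G \<phi> u w V) (ddir z \<phi> u)"
proof -
  have "ddir w (\<lambda>v. ddir (Y v) \<phi> v) u = ddir w V u"
    by (rule fun_cong[OF frechet_derivative_cong_on[OF U u eq]])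
  then have "cov_along G \<phi> u w (\<lambda>v. ddir (Y v) \<phi> v) = cov_along G \<phi> u w V"
    by (simp add: cov_along_def eq[OF u])
  then show ?thesis
    using gauss_formula[OF u smooth_on_differentiable[OF assms(2) u], of w z] by simp
qed

lemma ddir_T:
  assumes u: "u \<in> U"
  shows "ddir w T u = - \<nu> *\<^sub>R ddir w n u"
proof -
  have "(T has_derivative (\<lambda>w. 0 - \<nu> *\<^sub>R ddir w n u)) (at u)"
    unfolding T_def E3_def
    by (intro has_derivative_diff has_derivative_const has_derivative_scaleR_right has_derivative_frechet
      n_diff u)
  from fun_cong[OF frechet_derivative_at[OF this], of w] show ?thesis by simp
qed

lemma ddir_JT:
  assumes u: "u \<in> U"
  shows "ddir w JT u $ 1 = ddir w n u $ 2" "ddir w JT u $ 2 = \<delta> * ddir w n u $ 1"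
    "contact_form \<tau> (\<phi> u) (ddir w JT u) = \<tau> * (\<delta> * ddir w \<phi> u $ 1 * n u $ 1 - ddir w \<phi> u $ 2 * n u $ 2)"
proof -
  have "ddir w (\<lambda>u. JT u $ 1) u = ddir w (\<lambda>u. n u $ 2) u"
    by (rule fun_cong[OF frechet_derivative_cong_on[OF U u]]) (rule JT_components)
  then show "ddir w JT u $ 1 = ddir w n u $ 2"
    using ddir_nth[OF n_diff[OF u]] ddir_nth[OF smooth_on_differentiable[OF smooth_JT u]] by simp
  have "ddir w (\<lambda>u. JT u $ 2) u = ddir w (\<lambda>u. \<delta> * n u $ 1) u"
    by (rule fun_cong[OF frechet_derivative_cong_on[OF U u]]) (rule JT_components)
  also have "\<dots> = \<delta> * ddir w n u $ 1"
    by (rule fun_cong[OF frechet_derivative_at[OF has_derivative_mult_right[OF nth_derivative[OF n u]]], symmetric])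
  finally show "ddir w JT u $ 2 = \<delta> * ddir w n u $ 1"
    using ddir_nth[OF smooth_on_differentiable[OF smooth_JT u]] by simp
  have d: "((\<lambda>u. JT u $ 3 + \<tau> * (\<phi> u $ 2 * JT u $ 1 - \<phi> u $ 1 * JT u $ 2)) has_derivative
    (\<lambda>w. ddir w JT u $ 3 + \<tau> * ((\<phi> u $ 2 * ddir w JT u $ 1 + ddir w \<phi> u $ 2 * JT u $ 1)
       - (\<phi> u $ 1 * ddir w JT u $ 2 + ddir w \<phi> u $ 1 * JT u $ 2)))) (at u)"
    by (intro has_derivative_add has_derivative_diff has_derivative_mult has_derivative_mult_right
        nth_derivative smooth_JT \<phi> u)
  have k: "JT u $ 3 + \<tau> * (\<phi> u $ 2 * JT u $ 1 - \<phi> u $ 1 * JT u $ 2) = 0" if "u \<in> U" for u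
    using JT_components[OF that] by (simp add: contact_form_def)
  have "ddir w JT u $ 3 + \<tau> * ((\<phi> u $ 2 * ddir w JT u $ 1 + ddir w \<phi> u $ 2 * JT u $ 1)
       - (\<phi> u $ 1 * ddir w JT u $ 2 + ddir w \<phi> u $ 1 * JT u $ 2)) = 0"
    by (rule has_derivative_const_on[OF d U u k])
  then show "contact_form \<tau> (\<phi> u) (ddir w JT u) = \<tau> * (\<delta> * ddir w \<phi> u $ 1 * n u $ 1 - ddir w \<phi> u $ 2 * n u $ 2)"
    by (simp add: contact_form_def algebra_simps JT_components[OF u])
qed

text \<open>It suffices to compare inner products with \<open>T\<close> and \<open>JT\<close>, and by the Gauss formula these can be
  computed with the ambient connection.\<close>

lemma nabla_a:
  assumes u: "u \<in> U"
  shows "cov_along h (\<lambda>q. q) u w a = \<theta> u w *\<^sub>R b u"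
proof (rule frame_eqI[OF u])
  have push: "h u (cov_along h (\<lambda>q. q) u w a) z = G (\<phi> u) (cov_along G \<phi> u w T) (ddir z \<phi> u)" for z
    by (rule cov_push[OF u smooth_a push_a])
  note comps = heis_cov_along[OF \<delta>] ddir_T[OF u] dn_components[OF u] T_components[OF u] JT_components[OF u]
    linear_scale[OF contact_form_linear] linear_neg[OF contact_form_linear] \<eta>_def[symmetric]
  note bil = bilinear_lmul[OF induced.bilinear_G[OF u]] bilinear_lneg[OF induced.bilinear_G[OF u]]
  \<comment> \<open>Here and below \<open>x, y\<close> stand for \<open>N\<^sub>1, N\<^sub>2\<close>, further \<open>s\<close> and \<open>e\<close> for the values of \<open>\<omega>\<close> and \<open>\<eta>\<close> on the
    direction of differentiation, and \<open>x1, x2\<close> for its horizontal frame components.\<close>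
  have 1: "(- \<nu> * (\<delta> * y * s) + \<tau> * \<delta> * (e * (- \<nu> * y) + x2 * (1 - \<epsilon> * \<delta> * \<nu>\<^sup>2))) * (- \<nu> * x)
      - \<delta> * ((- \<nu> * (x * s) + \<tau> * (e * (- \<nu> * x) + x1 * (1 - \<epsilon> * \<delta> * \<nu>\<^sup>2))) * (- \<nu> * y))
      + \<delta> * ((- \<nu> * (\<tau> * (x1 * y - x2 * x))) * (1 - \<epsilon> * \<delta> * \<nu>\<^sup>2)) = 0" for x y s e x1 x2
    by (simp add: algebra_simps)
  have 2: "(- \<nu> * (\<delta> * y * s) + \<tau> * \<delta> * (e * (- \<nu> * y) + x2 * (1 - \<epsilon> * \<delta> * \<nu>\<^sup>2))) * y
      - \<delta> * ((- \<nu> * (x * s) + \<tau> * (e * (- \<nu> * x) + x1 * (1 - \<epsilon> * \<delta> * \<nu>\<^sup>2))) * (\<delta> * x))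
      + \<delta> * ((- \<nu> * (\<tau> * (x1 * y - x2 * x))) * 0)
      = (- \<nu> * \<delta> * (s + 2 * \<tau> * e)) * (- \<delta> * (\<epsilon> - \<delta> * \<nu>\<^sup>2))"
    if "x\<^sup>2 - \<delta> * y\<^sup>2 = \<epsilon> - \<delta> * \<nu>\<^sup>2" "x * x1 - \<delta> * (y * x2) + \<epsilon> * \<nu> * e = 0" for x y s e x1 x2
    using signs that by algebra
  show "h u (cov_along h (\<lambda>q. q) u w a) (a u) = h u (\<theta> u w *\<^sub>R b u) (a u)"
    unfolding push push_a[OF u] heis_metric_def[of _ _ "\<phi> u"]
    using gram_frame[OF u] induced.sym_G[OF u, of "b u" "a u"]
      1[of "n u $ 2" "\<omega> u w" "\<eta> u w" "ddir w \<phi> u $ 2" "n u $ 1" "ddir w \<phi> u $ 1"]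
    by (simp add: comps bil)
  show "h u (cov_along h (\<lambda>q. q) u w a) (b u) = h u (\<theta> u w *\<^sub>R b u) (b u)"
    unfolding push push_b[OF u] heis_metric_def[of _ _ "\<phi> u"]
    using gram_frame[OF u] 2[OF n_conic[OF u, unfolded c_def] normal_components[OF u, of w], of "\<omega> u w"]
    by (simp add: comps bil \<theta>_def c_def)
qed

lemma nabla_b:
  assumes u: "u \<in> U"
  shows "cov_along h (\<lambda>q. q) u w b = (\<epsilon> * \<theta> u w) *\<^sub>R a u"
proof (rule frame_eqI[OF u])
  have push: "h u (cov_along h (\<lambda>q. q) u w b) z = G (\<phi> u) (cov_along G \<phi> u w JT) (ddir z \<phi> u)" for z
    by (rule cov_push[OF u smooth_b push_b])
  note comps = heis_cov_along[OF \<delta>] ddir_JT[OF u] dn_components[OF u] T_components[OF u] JT_components[OF u]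
    \<eta>_def[symmetric]
  note bil = bilinear_lmul[OF induced.bilinear_G[OF u]] bilinear_lneg[OF induced.bilinear_G[OF u]]
  have 1: "(x * s + \<tau> * \<delta> * (e * (\<delta> * x) + x2 * 0)) * (- \<nu> * x)
      - \<delta> * ((\<delta> * (\<delta> * y * s) + \<tau> * (e * y + x1 * 0)) * (- \<nu> * y))
      + \<delta> * ((\<tau> * (\<delta> * x1 * x - x2 * y)) * (1 - \<epsilon> * \<delta> * \<nu>\<^sup>2))
      = (\<epsilon> * (- \<nu> * \<delta> * (s + 2 * \<tau> * e))) * (\<epsilon> * \<delta> * (\<epsilon> - \<delta> * \<nu>\<^sup>2))"
    if "x\<^sup>2 - \<delta> * y\<^sup>2 = \<epsilon> - \<delta> * \<nu>\<^sup>2" "x * x1 - \<delta> * (y * x2) + \<epsilon> * \<nu> * e = 0" for x y s e x1 x2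
    using signs that by algebra
  have 2: "(x * s + \<tau> * \<delta> * (e * (\<delta> * x) + x2 * 0)) * y
      - \<delta> * ((\<delta> * (\<delta> * y * s) + \<tau> * (e * y + x1 * 0)) * (\<delta> * x))
      + \<delta> * ((\<tau> * (\<delta> * x1 * x - x2 * y)) * 0) = 0" for x y s e x1 x2
    using \<delta> by (auto simp: algebra_simps)
  show "h u (cov_along h (\<lambda>q. q) u w b) (a u) = h u ((\<epsilon> * \<theta> u w) *\<^sub>R a u) (a u)"
    unfolding push push_a[OF u] heis_metric_def[of _ _ "\<phi> u"]
    using gram_frame[OF u] 1[OF n_conic[OF u, unfolded c_def] normal_components[OF u, of w], of "\<omega> u w"]
    by (simp add: comps bil \<theta>_def c_def)
  show "h u (cov_along h (\<lambda>q. q) u w b) (b u) = h u ((\<epsilon> * \<theta> u w) *\<^sub>R a u) (b u)"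
    unfolding push push_b[OF u] heis_metric_def[of _ _ "\<phi> u"]
    using gram_frame[OF u]
      2[of "n u $ 1" "\<omega> u w" "\<eta> u w" "ddir w \<phi> u $ 2" "n u $ 2" "ddir w \<phi> u $ 1"]
    by (simp add: comps bil)
qed

lemma \<theta>_frame:
  assumes u: "u \<in> U"
  shows "\<theta> u (a u) = - 2 * \<delta> * \<tau> * \<nu>" "\<theta> u (b u) = \<mu> u * \<nu>"
proof -
  have "- \<nu> * \<delta> * (2 * \<tau> * \<epsilon> * \<delta> * \<nu>\<^sup>2 + 2 * \<tau> * (1 - \<epsilon> * \<delta> * \<nu>\<^sup>2)) = - 2 * \<delta> * \<tau> * \<nu>"
    by (simp add: algebra_simps)
  then show "\<theta> u (a u) = - 2 * \<delta> * \<tau> * \<nu>" by (simp add: \<theta>_def \<omega>_a[OF u] \<eta>_frame[OF u])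
  show "\<theta> u (b u) = \<mu> u * \<nu>" using \<delta> by (auto simp: \<theta>_def \<omega>_b \<eta>_frame[OF u])
qed

lemma connection_frame:
  assumes u: "u \<in> U" and Y: "\<And>v. v \<in> U \<Longrightarrow> tangent_coords \<phi> v (Y v) = y v"
  shows "surface_connection G \<phi> X Y u = ddir (cov_along h (\<lambda>q. q) u (tangent_coords \<phi> u (X u)) y) \<phi> u"
proof -
  have "ddir w (\<lambda>v. tangent_coords \<phi> v (Y v)) u = ddir w y u" for w
    by (rule fun_cong[OF frechet_derivative_cong_on[OF U u Y]])
  then show ?thesis
    by (simp add: surface_connection_def levi_civita_def cov_along_id Y[OF u])
qed

lemma smooth_\<theta>: "smooth_on U (\<lambda>v. \<theta> v w)"
  unfolding \<theta>_def by (intro smooth_on_intros U smooth_\<omega> smooth_\<eta>)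

lemma d\<theta>:
  assumes u: "u \<in> U"
  shows "ddir v (\<lambda>u. \<theta> u w) u - ddir w (\<lambda>u. \<theta> u v) u
    = 4 * \<nu> * \<delta> * \<tau>\<^sup>2 * (ddir v \<phi> u $ 1 * ddir w \<phi> u $ 2 - ddir v \<phi> u $ 2 * ddir w \<phi> u $ 1)"
proof -
  have d: "ddir v (\<lambda>u. \<theta> u w) u = - \<nu> * \<delta> * (ddir v (\<lambda>u. \<omega> u w) u + 2 * \<tau> * ddir v (\<lambda>u. \<eta> u w) u)" for v w
  proof -
    have "((\<lambda>u. \<theta> u w) has_derivative (\<lambda>v. - \<nu> * \<delta> * (ddir v (\<lambda>u. \<omega> u w) u + 2 * \<tau> * ddir v (\<lambda>u. \<eta> u w) u))) (at u)"
      unfolding \<theta>_def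
      by (intro has_derivative_mult_right has_derivative_add has_derivative_frechet
          smooth_on_differentiable[OF smooth_\<omega> u] smooth_on_differentiable[OF smooth_\<eta> u])
    from fun_cong[OF frechet_derivative_at[OF this], of v] show ?thesis by simp
  qed
  have "ddir v (\<lambda>u. \<theta> u w) u - ddir w (\<lambda>u. \<theta> u v) u
      = - 2 * \<nu> * \<delta> * \<tau> * (ddir v (\<lambda>u. \<eta> u w) u - ddir w (\<lambda>u. \<eta> u v) u)"
    unfolding d \<omega>_closed[OF u, of v w] by (simp add: algebra_simps)
  then show ?thesis unfolding d\<eta>[OF u] by (simp add: algebra_simps power2_eq_square)
qed

lemma gauss_curvature_patch:
  assumes u: "u \<in> U"
  shows "gauss_curvature h u = 4 * \<delta> * \<epsilon> * \<tau>\<^sup>2 * \<nu>\<^sup>2"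
proof -
  have nz: "h u (a u) (a u) \<noteq> 0" "\<epsilon> \<noteq> 0" "h u (b u) (b u) = - \<epsilon> * h u (a u) (a u)"
    using gram_frame[OF u] c_nonzero \<delta> \<epsilon> by auto
  have "gauss_curvature h u * h u (a u) (a u) =
    - (4 * \<nu> * \<delta> * \<tau>\<^sup>2 * (ddir (axis 1 1) \<phi> u $ 1 * ddir (axis 2 1) \<phi> u $ 2 - ddir (axis 1 1) \<phi> u $ 2 * ddir (axis 2 1) \<phi> u $ 1))
      * (a u $ 1 * b u $ 2 - a u $ 2 * b u $ 1)"
    using induced.gauss_curvature_frame[OF u smooth_a smooth_b smooth_\<theta> nabla_a nabla_b gram_frame(2)[OF u] nz(3,1,2)]
    unfolding d\<theta>[OF u] .
  also have "\<dots> = - (4 * \<nu> * \<delta> * \<tau>\<^sup>2) * (T u $ 1 * JT u $ 2 - T u $ 2 * JT u $ 1)"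
  proof -
    have e: "ddir w \<phi> u = w$1 *\<^sub>R ddir (axis 1 1) \<phi> u + w$2 *\<^sub>R ddir (axis 2 1) \<phi> u" for w
      using ddir_expand[OF \<phi>_diff[OF u], of w] by (simp add: sum_2)
    show ?thesis
      unfolding push_a[OF u, symmetric] push_b[OF u, symmetric] e[of "a u"] e[of "b u"]
      by (simp add: algebra_simps)
  qed
  also have "\<dots> = 4 * \<delta> * \<epsilon> * \<tau>\<^sup>2 * \<nu>\<^sup>2 * (\<epsilon> * \<delta> * c)"
  proof -
    have "- (4 * \<nu> * \<delta> * \<tau>\<^sup>2) * ((- \<nu> * x) * (\<delta> * x) - (- \<nu> * y) * y) = 4 * \<delta> * \<epsilon> * \<tau>\<^sup>2 * \<nu>\<^sup>2 * (\<epsilon> * \<delta> * k)"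
      if "x\<^sup>2 - \<delta> * y\<^sup>2 = k" for x y k
      using signs that by algebra
    from this[OF n_conic[OF u]] show ?thesis unfolding T_components[OF u] JT_components[OF u] .
  qed
  finally show ?thesis using nz(1) unfolding gram_frame(1)[OF u] by simp
qed

lemma smooth_\<mu>: "smooth_on U \<mu>"
proof -
  have "smooth_on U (\<lambda>u. - \<delta> * (b u $ 1 * \<omega> u (axis 1 1) + b u $ 2 * \<omega> u (axis 2 1)))"
    by (intro smooth_on_intros U smooth_\<omega> smooth_b)
  moreover have "\<omega> u (b u) = b u $ 1 * \<omega> u (axis 1 1) + b u $ 2 * \<omega> u (axis 2 1)" if "u \<in> U" for u
  proof -
    note l = linear_\<omega>[OF that]
    have "\<omega> u (b u) = \<omega> u (b u $ 1 *\<^sub>R axis 1 1 + b u $ 2 *\<^sub>R axis 2 1)"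
      by (rule arg_cong[OF vec2_expand])
    then show ?thesis by (simp add: linear_add[OF l] linear_scale[OF l])
  qed
  ultimately show ?thesis
    by (elim smooth_on_cong[OF U, rotated]) (simp add: \<mu>_def)
qed

text \<open>\<open>d\<omega>(a,b) = 0\<close> together with constancy of \<open>\<omega>(a)\<close> gives \<open>a(\<omega>(b)) = \<omega>([a,b])\<close>, and the bracket is
  \<open>\<nabla>\<^sub>a b - \<nabla>\<^sub>b a = \<epsilon>\<theta>(a) a - \<theta>(b) b\<close>.\<close>

lemma \<mu>_riccati:
  assumes u: "u \<in> U"
  shows "ddir (a u) \<mu> u + (\<mu> u)\<^sup>2 * \<nu> - 4 * \<delta> * \<tau>\<^sup>2 * \<nu>^3 = 0"
proof -
  have lf: "ddir w (\<lambda>q. \<omega> q (Y q)) u = ddir w (\<lambda>q. \<omega> q (Y u)) u + \<omega> u (ddir w Y u)"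
    if "smooth_on U Y" for w Y
    by (rule ddir_linear_family[OF U u linear_\<omega> smooth_on_differentiable[OF smooth_\<omega> u]
          smooth_on_differentiable[OF that u]])
  have a0: "ddir (b u) (\<lambda>q. \<omega> q (a q)) u = 0"
    by (rule ddir_const_on[OF U u \<omega>_a])
  have bracket: "ddir (a u) b u - ddir (b u) a u = (\<epsilon> * \<theta> u (a u)) *\<^sub>R a u - \<theta> u (b u) *\<^sub>R b u"
    unfolding nabla_a[OF u, symmetric] nabla_b[OF u, symmetric]
    using induced.christoffel_form_sym[OF u, of "a u" "b u"] by (simp add: cov_along_id)
  have "ddir (a u) (\<lambda>q. \<omega> q (b q)) u = \<omega> u (ddir (a u) b u) - \<omega> u (ddir (b u) a u)"
    using lf[OF smooth_b, of "a u"] lf[OF smooth_a, of "b u"] a0 \<omega>_closed[OF u, of "a u" "b u"] by simp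
  also have "\<dots> = \<epsilon> * \<theta> u (a u) * \<omega> u (a u) - \<theta> u (b u) * \<omega> u (b u)"
    unfolding linear_diff[OF linear_\<omega>[OF u], symmetric] bracket
    by (simp add: linear_diff[OF linear_\<omega>[OF u]] linear_scale[OF linear_\<omega>[OF u]])
  finally have d\<omega>: "ddir (a u) (\<lambda>q. \<omega> q (b q)) u
      = \<epsilon> * (- 2 * \<delta> * \<tau> * \<nu>) * (2 * \<tau> * \<epsilon> * \<delta> * \<nu>\<^sup>2) - \<mu> u * \<nu> * (- \<delta> * \<mu> u)"
    unfolding \<theta>_frame[OF u] \<omega>_a[OF u] \<omega>_b .
  have "(\<lambda>q. \<omega> q (b q)) differentiable (at u)"
  proof (rule differentiable_cong_on[OF U u])
    show "(\<lambda>q. - \<delta> * \<mu> q) differentiable (at u)"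
      by (intro smooth_on_differentiable[OF _ u] smooth_on_intros U smooth_\<mu>)
  qed (rule \<omega>_b[symmetric])
  then have "(\<mu> has_derivative (\<lambda>w. - \<delta> * ddir w (\<lambda>q. \<omega> q (b q)) u)) (at u)"
    unfolding \<mu>_def by (intro has_derivative_mult_right has_derivative_frechet)
  from fun_cong[OF frechet_derivative_at[OF this], of "a u"]
  have d: "ddir (a u) \<mu> u = - \<delta> * ddir (a u) (\<lambda>q. \<omega> q (b q)) u" by simp
  have "- \<delta> * (\<epsilon> * (- 2 * \<delta> * \<tau> * \<nu>) * (2 * \<tau> * \<epsilon> * \<delta> * \<nu>\<^sup>2) - m * \<nu> * (- \<delta> * m)) + m\<^sup>2 * \<nu>
      - 4 * \<delta> * \<tau>\<^sup>2 * \<nu>^3 = 0" for m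
    using \<delta> \<epsilon> by (auto simp: algebra_simps power2_eq_square power3_eq_cube)
  then show ?thesis unfolding d d\<omega> .
qed

end

section \<open>Change of parametrization\<close>

text \<open>A continuous lift of a differentiable map through an immersion is differentiable. A left inverse
  \<open>L\<close> of the differential of \<open>\<phi>\<close> makes \<open>L \<circ> \<phi>\<close> tangent to the identity, so \<open>\<kappa>\<close> differs from the
  differentiable map \<open>L \<circ> \<phi>'\<close> by an error small relative to \<open>\<kappa> x - \<kappa> u\<close>; this first shows that \<open>\<kappa>\<close>
  is Lipschitz at \<open>u\<close>, and then that the error is small relative to \<open>x - u\<close>.\<close>

lemma has_derivative_lift:
  fixes \<kappa> :: "'a::real_normed_vector \<Rightarrow> 'b::euclidean_space" and \<phi> :: "'b \<Rightarrow> 'c::euclidean_space"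
  assumes V: "open V" "u \<in> V" and cont: "isCont \<kappa> u"
    and \<phi>': "(\<phi>' has_derivative A) (at u)" and \<phi>: "(\<phi> has_derivative B) (at (\<kappa> u))" and "inj B"
    and eq: "\<And>x. x \<in> V \<Longrightarrow> \<phi> (\<kappa> x) = \<phi>' x"
  shows "\<exists>K. (\<kappa> has_derivative K) (at u)"
proof -
  obtain L where L: "linear L" "L \<circ> B = id"
    using linear_injective_left_inverse[OF has_derivative_linear[OF \<phi>] \<open>inj B\<close>] by blast
  have bl: "bounded_linear L" using L(1) linear_conv_bounded_linear by blast
  define K where "K x = L (A x)" for x
  have dg: "((\<lambda>v. L (\<phi> v)) has_derivative (\<lambda>x. x)) (at (\<kappa> u))"
    using bounded_linear.has_derivative[OF bl \<phi>] L(2) by (simp add: o_def id_def fun_eq_iff)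
  have dK: "((\<lambda>x. L (\<phi>' x)) has_derivative K) (at u)"
    unfolding K_def by (rule bounded_linear.has_derivative[OF bl \<phi>'])
  have blK: "bounded_linear K" using dK by (rule has_derivative_bounded_linear)
  then obtain C where C: "C > 0" "\<And>x. norm (K x) \<le> norm x * C"
    using bounded_linear.pos_bounded by blast
  \<comment> \<open>the first-order expansions of \<open>L \<circ> \<phi>\<close> at \<open>\<kappa> u\<close>, evaluated at \<open>\<kappa> x\<close>, and of \<open>L \<circ> \<phi>'\<close> at \<open>u\<close>\<close>
  have near: "\<exists>d>0. \<forall>x. norm (x - u) < d \<longrightarrow>
       norm (L (\<phi>' x) - L (\<phi>' u) - (\<kappa> x - \<kappa> u)) \<le> e * norm (\<kappa> x - \<kappa> u)
       \<and> norm (L (\<phi>' x) - L (\<phi>' u) - K (x - u)) \<le> e * norm (x - u)" if e: "e > 0" for e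
  proof -
    obtain d1 where d1: "d1 > 0" "\<And>y. norm (y - \<kappa> u) < d1 \<Longrightarrow>
        norm (L (\<phi> y) - L (\<phi> (\<kappa> u)) - (y - \<kappa> u)) \<le> e * norm (y - \<kappa> u)"
      using conjunct2[OF dg[unfolded has_derivative_at_alt], rule_format, OF e] by blast
    obtain d2 where d2: "d2 > 0" "\<And>y. norm (y - u) < d2 \<Longrightarrow>
        norm (L (\<phi>' y) - L (\<phi>' u) - K (y - u)) \<le> e * norm (y - u)"
      using conjunct2[OF dK[unfolded has_derivative_at_alt], rule_format, OF e] by blast
    obtain d3 where d3: "d3 > 0" "\<And>y. norm (y - u) < d3 \<Longrightarrow> norm (\<kappa> y - \<kappa> u) < d1"
      using cont d1(1) unfolding continuous_at_eps_delta dist_norm by blast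
    obtain d4 where d4: "d4 > 0" "\<And>y. norm (y - u) < d4 \<Longrightarrow> y \<in> V"
      using V unfolding open_dist dist_norm by blast
    show ?thesis
    proof (intro exI[of _ "min d2 (min d3 d4)"] conjI allI impI)
      fix x assume "norm (x - u) < min d2 (min d3 d4)"
      then have x: "norm (x - u) < d2" "norm (x - u) < d3" "x \<in> V" using d4(2) by auto
      show "norm (L (\<phi>' x) - L (\<phi>' u) - (\<kappa> x - \<kappa> u)) \<le> e * norm (\<kappa> x - \<kappa> u)"
        using d1(2)[OF d3(2)[OF x(2)]] by (simp only: eq[OF x(3)] eq[OF V(2)])
      show "norm (L (\<phi>' x) - L (\<phi>' u) - K (x - u)) \<le> e * norm (x - u)"
        by (rule d2(2)[OF x(1)])
    qed (use d2(1) d3(1) d4(1) in simp)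
  qed
  obtain d0 where d0: "d0 > 0" "\<And>x. norm (x - u) < d0 \<Longrightarrow>
      norm (L (\<phi>' x) - L (\<phi>' u) - (\<kappa> x - \<kappa> u)) \<le> 1/2 * norm (\<kappa> x - \<kappa> u)
       \<and> norm (L (\<phi>' x) - L (\<phi>' u) - K (x - u)) \<le> 1/2 * norm (x - u)"
    using near[of "1/2"] by auto
  have lip: "norm (\<kappa> x - \<kappa> u) \<le> (2 * C + 1) * norm (x - u)" if "norm (x - u) < d0" for x
  proof -
    let ?z = "L (\<phi>' x) - L (\<phi>' u)"
    have "norm (\<kappa> x - \<kappa> u) \<le> norm ?z + norm (?z - (\<kappa> x - \<kappa> u))"
      by (metis norm_minus_commute norm_triangle_sub)
    then have "norm (\<kappa> x - \<kappa> u) \<le> 2 * norm ?z" using d0(2)[OF that] by simp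
    moreover have "norm ?z \<le> norm (K (x - u)) + norm (?z - K (x - u))" by (rule norm_triangle_sub)
    ultimately show ?thesis using d0(2)[OF that] C(2)[of "x - u"] by (simp add: algebra_simps)
  qed
  have "(\<kappa> has_derivative K) (at u)"
    unfolding has_derivative_at_alt
  proof (intro conjI blK allI impI)
    fix e :: real assume e: "e > 0"
    define e' where "e' = e / (2 * C + 2)"
    have e': "e' > 0" using e C by (simp add: e'_def)
    obtain d where d: "d > 0" "\<And>x. norm (x - u) < d \<Longrightarrow>
      norm (L (\<phi>' x) - L (\<phi>' u) - (\<kappa> x - \<kappa> u)) \<le> e' * norm (\<kappa> x - \<kappa> u)
       \<and> norm (L (\<phi>' x) - L (\<phi>' u) - K (x - u)) \<le> e' * norm (x - u)"
      using near[OF e'] by auto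
    show "\<exists>d>0. \<forall>y. norm (y - u) < d \<longrightarrow> norm (\<kappa> y - \<kappa> u - K (y - u)) \<le> e * norm (y - u)"
    proof (intro exI[of _ "min d d0"] conjI allI impI)
      fix x assume "norm (x - u) < min d d0"
      then have x: "norm (x - u) < d" "norm (x - u) < d0" by auto
      let ?z = "L (\<phi>' x) - L (\<phi>' u)"
      have "\<kappa> x - \<kappa> u - K (x - u) = (?z - K (x - u)) - (?z - (\<kappa> x - \<kappa> u))" by simp
      then have "norm (\<kappa> x - \<kappa> u - K (x - u)) \<le> norm (?z - K (x - u)) + norm (?z - (\<kappa> x - \<kappa> u))"
        by (metis norm_triangle_ineq4)
      also have "\<dots> \<le> e' * norm (x - u) + e' * norm (\<kappa> x - \<kappa> u)"
        using d(2)[OF x(1)] by simp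
      also have "\<dots> \<le> e' * norm (x - u) + e' * ((2 * C + 1) * norm (x - u))"
        using lip[OF x(2)] e' by simp
      also have "\<dots> = (e' * (2 * C + 2)) * norm (x - u)" by (simp add: algebra_simps)
      also have "e' * (2 * C + 2) = e" using C by (simp add: e'_def)
      finally show "norm (\<kappa> x - \<kappa> u - K (x - u)) \<le> e * norm (x - u)" .
    qed (use d d0 in auto)
  qed
  then show ?thesis by blast
qed

text \<open>\<open>K\<close> is the differential of the coordinate change at \<open>u1\<close>. The equation is the chain rule for any
  field \<open>g\<close> on the surface; it will be used for \<open>f\<close> and for the normal field.\<close>

lemma local_param_transition:
  assumes 1: "local_param M f U1 \<psi>1" "u1 \<in> U1" and 2: "local_param M f U2 \<psi>2" "u2 \<in> U2"
    and same: "\<psi>1 u1 = \<psi>2 u2"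
  shows "\<exists>K. \<forall>g::_ \<Rightarrow> real^3. (g \<circ> \<psi>2) differentiable (at u2) \<longrightarrow>
    (\<forall>w. ddir w (g \<circ> \<psi>1) u1 = ddir (K w) (g \<circ> \<psi>2) u2)"
proof -
  obtain \<rho> where \<rho>: "homeomorphic_maps (top_of_set U2) (subtopology M (\<psi>2 ` U2)) \<psi>2 \<rho>"
    using 2 unfolding local_param_def homeomorphic_map_maps by blast
  have o: "open U1" "openin M (\<psi>2 ` U2)" using 1 2 by (auto simp: local_param_def)
  have c1: "continuous_map (top_of_set U1) M \<psi>1"
    using 1 unfolding local_param_def by (meson continuous_map_in_subtopology homeomorphic_imp_continuous_map)
  define V where "V = {u \<in> U1. \<psi>1 u \<in> \<psi>2 ` U2}"
  have "openin (top_of_set U1) V"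
    using openin_continuous_map_preimage[OF c1 o(2)] by (simp add: V_def)
  then have V: "open V" using o(1) openin_open_eq by blast
  have u1: "u1 \<in> V" using 1 2 same by (auto simp: V_def)
  define \<kappa> where "\<kappa> = \<rho> \<circ> \<psi>1"
  have "continuous_map (top_of_set V) (subtopology M (\<psi>2 ` U2)) \<psi>1"
  proof -
    have "continuous_map (top_of_set V) M \<psi>1"
      using continuous_map_from_subtopology_mono[OF c1, of V] by (auto simp: V_def)
    then show ?thesis by (auto simp: continuous_map_in_subtopology V_def)
  qed
  then have "continuous_map (top_of_set V) (top_of_set U2) \<kappa>"
    using \<rho> unfolding \<kappa>_def homeomorphic_maps_def by (blast intro: continuous_map_compose)
  then have "continuous_on V \<kappa>" by (simp add: continuous_map_in_subtopology)
  then have cont: "isCont \<kappa> u1" using V u1 continuous_on_eq_continuous_at by blast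
  have "topspace (subtopology M (\<psi>2 ` U2)) = \<psi>2 ` U2" using openin_subset[OF o(2)] by auto
  then have lift: "\<psi>2 (\<kappa> u) = \<psi>1 u" if "u \<in> V" for u
    using \<rho> that by (auto simp: \<kappa>_def homeomorphic_maps_def V_def)
  have \<kappa>1: "\<kappa> u1 = u2" using \<rho> 2 same by (simp add: \<kappa>_def homeomorphic_maps_def)
  have d: "(f \<circ> \<psi>1) differentiable (at u1)" "(f \<circ> \<psi>2) differentiable (at u2)"
    and inj: "inj (frechet_derivative (f \<circ> \<psi>2) (at u2))"
    using 1 2 smooth_on_differentiable by (auto simp: local_param_def)
  have "\<exists>K. (\<kappa> has_derivative K) (at u1)"
    by (rule has_derivative_lift[OF V u1 cont has_derivative_frechet[OF d(1)]
          has_derivative_frechet[OF d(2), folded \<kappa>1], unfolded \<kappa>1, OF inj]) (use lift in auto)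
  then obtain K where K: "(\<kappa> has_derivative K) (at u1)" by blast
  show ?thesis
  proof (intro exI[of _ K] allI impI)
    fix g :: "_ \<Rightarrow> real^3" and w assume g: "(g \<circ> \<psi>2) differentiable (at u2)"
    have "((\<lambda>x. (g \<circ> \<psi>2) (\<kappa> x)) has_derivative (\<lambda>w. ddir (K w) (g \<circ> \<psi>2) u2)) (at u1)"
      using has_derivative_compose[OF K, of "g \<circ> \<psi>2", unfolded \<kappa>1, OF has_derivative_frechet[OF g]] .
    then have "((g \<circ> \<psi>1) has_derivative (\<lambda>w. ddir (K w) (g \<circ> \<psi>2) u2)) (at u1)"
      by (rule has_derivative_transform_within_open[OF _ V u1]) (simp add: lift)
    from fun_cong[OF frechet_derivative_at[OF this], of w]
    show "ddir w (g \<circ> \<psi>1) u1 = ddir (K w) (g \<circ> \<psi>2) u2" by simp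
  qed
qed

section \<open>Helix surfaces\<close>

text \<open>The function \<open>\<mu> = -\<delta> \<omega>(JT)\<close> of one parametrization, in terms of data on \<open>M\<close>.\<close>

definition normal_turning ::
  "real \<Rightarrow> real \<Rightarrow> real \<Rightarrow> real \<Rightarrow> ('a \<Rightarrow> real^3) \<Rightarrow> ('a \<Rightarrow> real^3) \<Rightarrow> (real^2 \<Rightarrow> 'a) \<Rightarrow> real^2 \<Rightarrow> real" where
  "normal_turning \<tau> \<delta> \<epsilon> \<nu> f N \<psi> u =
    (let d = ddir (tangent_coords (f \<circ> \<psi>) u (JT_field \<tau> \<delta> \<epsilon> f N (\<psi> u))) (N \<circ> \<psi>) u
     in - \<delta> * ((N (\<psi> u) $ 1 * d $ 2 - N (\<psi> u) $ 2 * d $ 1) / (\<epsilon> - \<delta> * \<nu>\<^sup>2)))"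

lemma helix_surface_patch:
  assumes \<delta>: "\<delta> \<in> {1, -1}" and \<epsilon>: "\<epsilon> \<in> {1, -1}"
    and helix: "helix_surface \<tau> \<delta> \<epsilon> M f N \<nu>"
    and basis: "\<forall>p\<in>topspace M. T_field \<tau> \<delta> \<epsilon> f N p \<noteq> JT_field \<tau> \<delta> \<epsilon> f N p \<and>
                  independent {T_field \<tau> \<delta> \<epsilon> f N p, JT_field \<tau> \<delta> \<epsilon> f N p}"
    and param: "local_param M f U \<psi>" and u0: "u0 \<in> U"
  shows "helix_patch \<tau> \<delta> \<epsilon> \<nu> U (f \<circ> \<psi>) (N \<circ> \<psi>)"
    and "\<And>u. u \<in> U \<Longrightarrow> constant_angle_patch.T \<nu> (f \<circ> \<psi>) (N \<circ> \<psi>) u = T_field \<tau> \<delta> \<epsilon> f N (\<psi> u)"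
    and "\<And>u. u \<in> U \<Longrightarrow> constant_angle_patch.JT \<tau> \<delta> \<nu> (f \<circ> \<psi>) (N \<circ> \<psi>) u = JT_field \<tau> \<delta> \<epsilon> f N (\<psi> u)"
    and "\<And>u. u \<in> U \<Longrightarrow> constant_angle_patch.\<mu> \<tau> \<delta> \<epsilon> \<nu> (f \<circ> \<psi>) (N \<circ> \<psi>) u = normal_turning \<tau> \<delta> \<epsilon> \<nu> f N \<psi> u"
proof -
  have inM: "\<psi> u \<in> topspace M" if "u \<in> U" for u
    using param openin_subset that unfolding local_param_def by blast
  note o = helix[unfolded helix_surface_def oriented_surface_def]
  have ang: "angle_function \<tau> \<delta> \<epsilon> f N (\<psi> u) = \<nu>" if "u \<in> U" for u
    using o inM[OF that] by blast
  interpret constant_angle_patch \<tau> \<delta> \<epsilon> \<nu> U "f \<circ> \<psi>" "N \<circ> \<psi>"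
  proof
    show "open U" "smooth_on U (f \<circ> \<psi>)" using param by (auto simp: local_param_def)
    show "smooth_on U (N \<circ> \<psi>)" using o param by (auto simp: smooth_on_surface_def)
    fix u assume u: "u \<in> U"
    show "v = 0" if "\<And>w. induced_metric (heis_metric \<tau> \<delta>) (f \<circ> \<psi>) u v w = 0" for v
      using o param u that by blast
    show "heis_metric \<tau> \<delta> ((f \<circ> \<psi>) u) ((N \<circ> \<psi>) u) ((N \<circ> \<psi>) u) = \<epsilon>"
      using o inM[OF u] by simp
    show "heis_metric \<tau> \<delta> ((f \<circ> \<psi>) u) ((N \<circ> \<psi>) u) (ddir v (f \<circ> \<psi>) u) = 0" for v
      using o param u by simp
    show "\<epsilon> * heis_metric \<tau> \<delta> ((f \<circ> \<psi>) u) ((N \<circ> \<psi>) u) (E3 ((f \<circ> \<psi>) u)) = \<nu>"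
      using ang[OF u] by (simp add: angle_function_def)
  qed (use \<delta> \<epsilon> in auto)
  show T: "T u = T_field \<tau> \<delta> \<epsilon> f N (\<psi> u)" if "u \<in> U" for u
    by (simp add: T_def T_field_def ang[OF that])
  show JT: "JT u = JT_field \<tau> \<delta> \<epsilon> f N (\<psi> u)" if "u \<in> U" for u
    by (simp add: JT_def JT_field_def T[OF that])
  show "\<mu> u = normal_turning \<tau> \<delta> \<epsilon> \<nu> f N \<psi> u" if "u \<in> U" for u
    by (simp add: normal_turning_def Let_def \<mu>_def \<omega>_def b_def c_def JT[OF that])
  show "helix_patch \<tau> \<delta> \<epsilon> \<nu> U (f \<circ> \<psi>) (N \<circ> \<psi>)"
    using c_nonzero_if_independent[OF u0] basis inM[OF u0]
    by unfold_locales (auto simp: T[OF u0] JT[OF u0] c_def)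
qed

theorem proposition4p1:
  fixes \<tau> \<delta> \<epsilon> \<nu> :: real
    and M :: "'a topology" and f N :: "'a \<Rightarrow> real^3"
  assumes "\<tau> \<noteq> 0" and "\<delta> \<in> {1, -1}" and "\<epsilon> \<in> {1, -1}"
    and helix: "helix_surface \<tau> \<delta> \<epsilon> M f N \<nu>"
    and basis: "\<forall>p\<in>topspace M. T_field \<tau> \<delta> \<epsilon> f N p \<noteq> JT_field \<tau> \<delta> \<epsilon> f N p \<and>
                  independent {T_field \<tau> \<delta> \<epsilon> f N p, JT_field \<tau> \<delta> \<epsilon> f N p}"
  shows "\<exists>\<mu>. smooth_on_surface M f \<mu> \<and>
    (\<forall>U \<psi>. local_param M f U \<psi> \<longrightarrow>
      (let G = heis_metric \<tau> \<delta>;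
           \<phi> = f \<circ> \<psi>;
           T = T_field \<tau> \<delta> \<epsilon> f N \<circ> \<psi>;
           JT = JT_field \<tau> \<delta> \<epsilon> f N \<circ> \<psi>;
           m = \<mu> \<circ> \<psi>;
           S = shape_operator G \<phi> (N \<circ> \<psi>);
           nabla = surface_connection G \<phi>
       in \<forall>u\<in>U.
         (S u (T u) = (- \<delta> * \<tau>) *\<^sub>R JT u \<and>
          S u (JT u) = (\<delta> * \<epsilon> * \<tau>) *\<^sub>R T u + m u *\<^sub>R JT u) \<and>
         (nabla T T u = (- 2 * \<delta> * \<tau> * \<nu>) *\<^sub>R JT u \<and>
          nabla JT T u = (m u * \<nu>) *\<^sub>R JT u \<and>
          nabla T JT u = (- 2 * \<epsilon> * \<delta> * \<tau> * \<nu>) *\<^sub>R T u \<and>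
          nabla JT JT u = (\<epsilon> * m u * \<nu>) *\<^sub>R T u) \<and>
         gauss_curvature (induced_metric G \<phi>) u = 4 * \<delta> * \<epsilon> * \<tau>\<^sup>2 * \<nu>\<^sup>2 \<and>
         dir_deriv \<phi> u (T u) m + (m u)\<^sup>2 * \<nu> - 4 * \<delta> * \<tau>\<^sup>2 * \<nu>^3 = 0))"
proof -
  note patch = helix_surface_patch[OF assms(2,3) helix basis]
  let ?turn = "normal_turning \<tau> \<delta> \<epsilon> \<nu> f N"
  have invariant: "?turn \<psi>1 u1 = ?turn \<psi>2 u2"
    if 1: "local_param M f U1 \<psi>1" "u1 \<in> U1" and 2: "local_param M f U2 \<psi>2" "u2 \<in> U2"
      and same: "\<psi>1 u1 = \<psi>2 u2" for U1 \<psi>1 u1 U2 \<psi>2 u2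
  proof -
    interpret P1: helix_patch \<tau> \<delta> \<epsilon> \<nu> U1 "f \<circ> \<psi>1" "N \<circ> \<psi>1" by (rule patch(1)[OF 1])
    interpret P2: helix_patch \<tau> \<delta> \<epsilon> \<nu> U2 "f \<circ> \<psi>2" "N \<circ> \<psi>2" by (rule patch(1)[OF 2])
    obtain K where K: "\<And>g::_ \<Rightarrow> real^3. (g \<circ> \<psi>2) differentiable (at u2) \<Longrightarrow>
        (\<forall>w. ddir w (g \<circ> \<psi>1) u1 = ddir (K w) (g \<circ> \<psi>2) u2)"
      using local_param_transition[OF 1 2 same] by blast
    have Kf: "ddir w (f \<circ> \<psi>1) u1 = ddir (K w) (f \<circ> \<psi>2) u2"
      and KN: "ddir w (N \<circ> \<psi>1) u1 = ddir (K w) (N \<circ> \<psi>2) u2" for w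
      using K[of f] K[of N] P2.\<phi>_diff[OF 2(2)] P2.n_diff[OF 2(2)] by blast+
    have "ddir (K (P1.b u1)) (f \<circ> \<psi>2) u2 = ddir (P2.b u2) (f \<circ> \<psi>2) u2"
      unfolding Kf[symmetric] P1.push_b[OF 1(2)] P2.push_b[OF 2(2)]
        patch(3)[OF 1 1(2)] patch(3)[OF 2 2(2)] by (simp add: same)
    then have "K (P1.b u1) = P2.b u2" by (rule P2.tangent_inj[OF 2(2)])
    then have "P1.\<mu> u1 = P2.\<mu> u2"
      using same by (simp add: P1.\<mu>_def P2.\<mu>_def P1.\<omega>_def P2.\<omega>_def KN)
    then show ?thesis by (simp add: patch(4)[OF 1 1(2)] patch(4)[OF 2 2(2)])
  qed
  \<comment> \<open>every point has a parametrization, and by invariance all of them give the same value\<close>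
  define \<mu> where "\<mu> p = (SOME r. \<exists>U \<psi> u. local_param M f U \<psi> \<and> u \<in> U \<and> \<psi> u = p \<and> r = ?turn \<psi> u)" for p
  have \<mu>: "\<mu> (\<psi> u) = ?turn \<psi> u" if "local_param M f U \<psi>" "u \<in> U" for U \<psi> u
    unfolding \<mu>_def by (rule some_equality) (use that invariant in blast)+
  show ?thesis
    unfolding smooth_on_surface_def Let_def
  proof (intro exI[of _ \<mu>] conjI allI impI ballI)
    fix U \<psi> assume param: "local_param M f U \<psi>"
    show "smooth_on U (\<mu> \<circ> \<psi>)"
    proof (cases "U = {}")
      case False
      then obtain u0 where u0: "u0 \<in> U" by blast
      interpret P: helix_patch \<tau> \<delta> \<epsilon> \<nu> U "f \<circ> \<psi>" "N \<circ> \<psi>" by (rule patch(1)[OF param u0])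
      show ?thesis
        by (rule smooth_on_cong[OF P.U _ P.smooth_\<mu>]) (simp add: \<mu>[OF param] patch(4)[OF param])
    qed (simp add: smooth_on_empty)
  next
    fix U \<psi> u assume param: "local_param M f U \<psi>" and u: "u \<in> U"
    let ?\<phi> = "f \<circ> \<psi>" and ?T = "T_field \<tau> \<delta> \<epsilon> f N \<circ> \<psi>" and ?JT = "JT_field \<tau> \<delta> \<epsilon> f N \<circ> \<psi>"
    interpret P: helix_patch \<tau> \<delta> \<epsilon> \<nu> U "f \<circ> \<psi>" "N \<circ> \<psi>" by (rule patch(1)[OF param u])
    have T: "?T v = P.T v" and JT: "?JT v = P.JT v" and m: "(\<mu> \<circ> \<psi>) v = P.\<mu> v" if "v \<in> U" for v
      using that by (simp_all add: patch(2-4)[OF param] \<mu>[OF param])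
    have a: "tangent_coords ?\<phi> v (?T v) = P.a v" and b: "tangent_coords ?\<phi> v (?JT v) = P.b v"
      if "v \<in> U" for v
      by (simp_all only: T[OF that] JT[OF that] P.a_def P.b_def)
    have conn: "surface_connection P.G ?\<phi> X ?T u = ddir (cov_along P.h (\<lambda>q. q) u (tangent_coords ?\<phi> u (X u)) P.a) ?\<phi> u"
      "surface_connection P.G ?\<phi> X ?JT u = ddir (cov_along P.h (\<lambda>q. q) u (tangent_coords ?\<phi> u (X u)) P.b) ?\<phi> u" for X
      by (rule P.connection_frame[OF u], erule a, rule P.connection_frame[OF u], erule b)
    note lin = linear_scale[OF ddir_linear[OF P.\<phi>_diff[OF u]]]
    show "shape_operator P.G ?\<phi> (N \<circ> \<psi>) u (?T u) = (- \<delta> * \<tau>) *\<^sub>R ?JT u"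
      unfolding shape_operator_def a[OF u] P.cov_n_a[OF u] JT[OF u] by simp
    show "shape_operator P.G ?\<phi> (N \<circ> \<psi>) u (?JT u) = (\<delta> * \<epsilon> * \<tau>) *\<^sub>R ?T u + (\<mu> \<circ> \<psi>) u *\<^sub>R ?JT u"
      unfolding shape_operator_def b[OF u] P.cov_n_b[OF u] unfolding JT[OF u] T[OF u] m[OF u] by simp
    show "surface_connection P.G ?\<phi> ?T ?T u = (- 2 * \<delta> * \<tau> * \<nu>) *\<^sub>R ?JT u"
      unfolding conn a[OF u] P.nabla_a[OF u] lin P.push_b[OF u]
      unfolding JT[OF u] P.\<theta>_frame[OF u] ..
    show "surface_connection P.G ?\<phi> ?JT ?T u = ((\<mu> \<circ> \<psi>) u * \<nu>) *\<^sub>R ?JT u"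
      unfolding conn b[OF u] P.nabla_a[OF u] lin P.push_b[OF u]
      unfolding JT[OF u] m[OF u]
        P.\<theta>_frame[OF u] ..
    show "surface_connection P.G ?\<phi> ?T ?JT u = (- 2 * \<epsilon> * \<delta> * \<tau> * \<nu>) *\<^sub>R ?T u"
      unfolding conn a[OF u] P.nabla_b[OF u] lin P.push_a[OF u]
      unfolding T[OF u] P.\<theta>_frame[OF u]
      by (simp add: mult_ac)
    show "surface_connection P.G ?\<phi> ?JT ?JT u = (\<epsilon> * (\<mu> \<circ> \<psi>) u * \<nu>) *\<^sub>R ?T u"
      unfolding conn b[OF u] P.nabla_b[OF u] lin P.push_a[OF u]
      unfolding T[OF u] m[OF u]
        P.\<theta>_frame[OF u] by (simp add: mult_ac)
    show "gauss_curvature (induced_metric P.G ?\<phi>) u = 4 * \<delta> * \<epsilon> * \<tau>\<^sup>2 * \<nu>\<^sup>2"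
      by (rule P.gauss_curvature_patch[OF u])
    show "dir_deriv ?\<phi> u (?T u) (\<mu> \<circ> \<psi>) + ((\<mu> \<circ> \<psi>) u)\<^sup>2 * \<nu> - 4 * \<delta> * \<tau>\<^sup>2 * \<nu>^3 = 0"
    proof -
      have "frechet_derivative (\<mu> \<circ> \<psi>) (at u) = frechet_derivative P.\<mu> (at u)"
        by (rule frechet_derivative_cong_on[OF P.U u]) (erule m)
      then show ?thesis
        unfolding dir_deriv_def a[OF u] m[OF u] using P.\<mu>_riccati[OF u] by simp
    qed
  qed
qed

end
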